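(* For every positive integer $n$ and all $S,T\subseteq[n]$ with $|S|=|T|$, the map $\phi$ (defined in the context), when restricted to $P_n(S,T)$, is a bijection from $P_n(S,T)$ to itself.
   Context: **Set partitions.** $[n]=\{1,\dots,n\}$. For a set partition $P$ of $[n]$, its arcs are the pairs $(i,j)$, $i<j$, such that $i,j$ are consecutive elements (in numerical order) of the same block; $i$ is the left-hand endpoint and $j$ the right-hand endpoint. The set of arcs determines $P$. $\min(P)$ (resp. $\max(P)$) is the set of minimal (resp. maximal) elements of the blocks of $P$, and $P_n(S,T)$ is the set of partitions $P$ of $[n]$ with $\min(P)=S$ and $\max(P)=T$. A matching is a partition all of whose blocks have two elements. Two arcs cross if, naming them suitably as $(a,b),(c,d)$, one has $a<c<b<d$. **Reduction to matchings.** Given $P\in P_n(S,T)$, replace each $i\notin S\cup T$ by two neighbouring points $i^0<i^1$ such that the arc ending at $i$ now ends at $i^0$ and the arc starting at $i$ now starts at $i^1$; remove all isolated points. This gives a matching $M(P)$ on a linearly ordered vertex set. $\phi(P)$ is obtained from $\phi(M(P))$ by identifying each pair $i^0,i^1$ to one point $i$ and adding back all isolated vertices. So it suffices to define $\phi$ on matchings. It is extended from matchings of $[2m]$ to matchings on any vertices $a_1<\dots<a_{2m}$ by identifying $a_i$ with $i$. ($\phi$ of the empty matching is the empty matching.) **Definition of $\phi$ on matchings of $[2m]$, by induction on $m$.** For $m=1$, $\phi$ is the identity. For $m>1$, let $(i,2m)$ be the arc of $M$ incident to $2m$, let $M_1=M\setminus\{(i,2m)\}$ and $M_1'=\phi(M_1)$.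 An arc $(a,b)$ is *large* if $a<i$ and *small* if $a>i$. Let $\mathcal R$ be the set of right-hand endpoints of $M_1'$ lying between $i$ and $2m$. Define the critical large arc $e_L=(e_L^l,e_L^r)$ of $M_1'$ as the large arc with the biggest right-hand endpoint in $\mathcal R$, and the critical small arc $e_S=(e_S^l,e_S^r)$ as the small arc with the smallest left-hand endpoint which crosses $e_L$. If both exist, set $\mathcal R_0=\{j\in\mathcal R:e_S^r<j<2m\}$, $\mathcal R_1=\{j\in\mathcal R:e_S^l<j\le e_S^r\}$, $\mathcal R_2=\{j\in\mathcal R:i<j<e_S^l\}$. If $e_L$ does not exist, set $\mathcal R_1=\mathcal R_2=\emptyset$, $\mathcal R_0=\mathcal R$. If $e_L$ exists but no small arc crosses it, set $\mathcal R_2=\{j\in\mathcal R:i<j\le e_L^r\}$, $\mathcal R_1=\emptyset$, $\mathcal R_0=\mathcal R\setminus\mathcal R_2$. These sets are computed once from $M_1'$. Then $M_1'$ is transformed as follows (the arcs referred to in each step are those of the current matching). Arcs whose right-hand endpoints are in $\mathcal R_0$ are fixed. First apply Algorithm I, then Algorithm II. *Algorithm I* (if $\mathcal R_1\ne\emptyset$). (A) Let $ptr_1$ point to $e_S^r$ and $ptr_2$ to the next vertex of $\mathcal R_1$ on the left of $e_S^r$. (B) If $ptr_2$ is null, stop. Otherwise let $ptr_1=j_1$, $ptr_2=j_2$, where $j_1,j_2$ are the right-hand endpoints of the arcs $(i_1,j_1)$ and $(i_2,j_2)$. (B1) If $(i_2,j_2)$ is large, change $\{(i_1,j_1),(i_2,j_2)\}$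 to $\{(i_1,j_2),(i_2,j_1)\}$ and move $ptr_1$ to $j_2$. (B2) If $(i_2,j_2)$ is small: (B2.1) if there is no right-hand endpoint between $i_1$ and $i_2$, move $ptr_1$ to $j_2$; (B2.2) if $i_1<i_2$ and there are right-hand endpoints between $i_1$ and $i_2$, do nothing; (B2.3) if $i_2<i_1$ and there are right-hand endpoints between $i_1$ and $i_2$, find the smallest $j_3>j_1$ such that $(i_3,j_3)$ is a large arc, change $\{(i_1,j_1),(i_2,j_2),(i_3,j_3)\}$ to $\{(i_1,j_2),(i_2,j_3),(i_3,j_1)\}$, and move $ptr_1$ to $j_2$. (C) Move $ptr_2$ to the next vertex of $\mathcal R_1$ on the left of $j_2$ and go to (B). *Algorithm II* (if $\mathcal R_2\neq\emptyset$). Let $t_0$ be the rightmost vertex of $\mathcal R_2$, the right-hand endpoint of the arc $(i_0,t_0)$. Pre-process: if $(i_0,t_0)$ is small, find the large arc $(i_1,t_1)$ with $t_1>t_0$ and $t_1$ smallest (it exists), and change $\{(i_0,t_0),(i_1,t_1)\}$ to $\{(i_0,t_1),(i_1,t_0)\}$. Then: (A$'$) Let $ptr_1$ point to $t_0$ and $ptr_2$ to the next vertex of $\mathcal R$ on the left of $t_0$. (B$'$) If $ptr_2$ is null, stop. Otherwise let $ptr_1=j_1$, $ptr_2=j_2$, right-hand endpoints of the arcs $(i_1,j_1)$, $(i_2,j_2)$. (B$'$1) If $(i_2,j_2)$ is large, do nothing. (B$'$2) If $(i_2,j_2)$ is small, change the two arcs to $(i_1,j_2)$ and $(i_2,j_1)$.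 (C$'$) Move $ptr_1$ to $j_2$ and $ptr_2$ to the next vertex of $\mathcal R$ on the left of $j_2$; go to (B$'$). Let $M_2$ be the resulting matching. Then $\phi(M)=M_2\cup\{(i,2m)\}$. *)

theory Defs
  imports "HOL-Library.Disjoint_Sets"
begin

section \<open>Set partitions, arcs and matchings\<close>

type_synonym arcs = "(nat \<times> nat) set"

definition block_arcs :: "nat set set \<Rightarrow> arcs" where
  "block_arcs P = {(i, j). i < j \<and> (\<exists>B\<in>P. i \<in> B \<and> j \<in> B \<and> \<not> (\<exists>k\<in>B. i < k \<and> k < j))}"

text \<open>The partition of \<open>V\<close> determined by its set of arcs \<open>E\<close>: its blocks are the connected
  components of the graph \<open>(V, E)\<close>.\<close>

definition partition_of_arcs :: "nat set \<Rightarrow> arcs \<Rightarrow> nat set set" where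
  "partition_of_arcs V E = V // {(x, y) \<in> V \<times> V. (x, y) \<in> (E \<union> E\<inverse>)\<^sup>*}"

definition partitions_min_max :: "nat \<Rightarrow> nat set \<Rightarrow> nat set \<Rightarrow> nat set set set" where
  "partitions_min_max n S T = {P. partition_on {1..n} P \<and> Min ` P = S \<and> Max ` P = T}"

definition crosses :: "nat \<times> nat \<Rightarrow> nat \<times> nat \<Rightarrow> bool" where
  "crosses e f \<longleftrightarrow>
     (fst e < fst f \<and> fst f < snd e \<and> snd e < snd f) \<or>
     (fst f < fst e \<and> fst e < snd f \<and> snd f < snd e)"

text \<open>A matching is represented by its set of arcs, so that its vertex set is \<open>Field M\<close>.\<close>

definition left_of :: "arcs \<Rightarrow> nat \<Rightarrow> nat" where
  "left_of M j = (THE a. (a, j) \<in> M)"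

definition right_of :: "arcs \<Rightarrow> nat \<Rightarrow> nat" where
  "right_of M a = (THE j. (a, j) \<in> M)"

text \<open>Interchange the right-hand endpoints \<open>j\<^sub>1\<close> and \<open>j\<^sub>2\<close> of two arcs.\<close>

definition swap_right :: "nat \<Rightarrow> nat \<Rightarrow> arcs \<Rightarrow> arcs" where
  "swap_right j\<^sub>1 j\<^sub>2 M =
     (let i\<^sub>1 = left_of M j\<^sub>1; i\<^sub>2 = left_of M j\<^sub>2
      in (M - {(i\<^sub>1, j\<^sub>1), (i\<^sub>2, j\<^sub>2)}) \<union> {(i\<^sub>1, j\<^sub>2), (i\<^sub>2, j\<^sub>1)})"

section \<open>The critical arcs and the sets of right-hand endpoints\<close>

text \<open>Throughout, \<open>(i, N)\<close> is the arc incident to the last vertex \<open>N\<close>, and \<open>M\<close> is the matching on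
  the remaining vertices. An arc is large if its left-hand endpoint is smaller than \<open>i\<close>, and small
  if it is bigger than \<open>i\<close>. As \<open>i\<close> is not a vertex of \<open>M\<close>, every arc is large or small.\<close>

definition right_ends :: "nat \<Rightarrow> nat \<Rightarrow> arcs \<Rightarrow> nat set" where
  "right_ends i N M = {j \<in> snd ` M. i < j \<and> j < N}"

definition large_candidates :: "nat \<Rightarrow> nat \<Rightarrow> arcs \<Rightarrow> arcs" where
  "large_candidates i N M = {(a, b) \<in> M. a < i \<and> b \<in> right_ends i N M}"

definition critical_large :: "nat \<Rightarrow> nat \<Rightarrow> arcs \<Rightarrow> nat \<times> nat" where
  "critical_large i N M = (let r = Max (snd ` large_candidates i N M) in (left_of M r, r))"

definition small_candidates :: "nat \<Rightarrow> nat \<Rightarrow> arcs \<Rightarrow> arcs" where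
  "small_candidates i N M = {(a, b) \<in> M. i < a \<and> crosses (a, b) (critical_large i N M)}"

definition critical_small :: "nat \<Rightarrow> nat \<Rightarrow> arcs \<Rightarrow> nat \<times> nat" where
  "critical_small i N M = (let l = Min (fst ` small_candidates i N M) in (l, right_of M l))"

text \<open>The critical large arc exists iff \<open>large_candidates\<close> is nonempty; if it does, then the critical
  small arc exists iff \<open>small_candidates\<close> is nonempty. The remaining right-hand endpoints form the
  set \<open>R\<^sub>0\<close>; the algorithms never refer to it.\<close>

definition R1 :: "nat \<Rightarrow> nat \<Rightarrow> arcs \<Rightarrow> nat set" where
  "R1 i N M =
     (if large_candidates i N M = {} \<or> small_candidates i N M = {} then {}
      else {j \<in> right_ends i N M. fst (critical_small i N M) < j \<and> j \<le> snd (critical_small i N M)})"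

definition R2 :: "nat \<Rightarrow> nat \<Rightarrow> arcs \<Rightarrow> nat set" where
  "R2 i N M =
     (if large_candidates i N M = {} then {}
      else if small_candidates i N M = {}
        then {j \<in> right_ends i N M. i < j \<and> j \<le> snd (critical_large i N M)}
      else {j \<in> right_ends i N M. i < j \<and> j < fst (critical_small i N M)})"

text \<open>The smallest right-hand endpoint beyond \<open>j\<close> of a large arc.\<close>

definition next_large :: "nat \<Rightarrow> arcs \<Rightarrow> nat \<Rightarrow> nat" where
  "next_large i M j = (LEAST k. j < k \<and> (\<exists>a<i. (a, k) \<in> M))"

section \<open>Algorithms I and II\<close>

text \<open>In both algorithms \<open>ptr\<^sub>2\<close> runs through a fixed set of vertices from right to left, so each is a
  fold over the decreasing list of these vertices; the state consists of the current matching and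
  the position of \<open>ptr\<^sub>1\<close>.\<close>

definition step_I :: "nat \<Rightarrow> nat \<Rightarrow> arcs \<times> nat \<Rightarrow> arcs \<times> nat" where
  "step_I i j\<^sub>2 = (\<lambda>(M, j\<^sub>1).
     let i\<^sub>1 = left_of M j\<^sub>1; i\<^sub>2 = left_of M j\<^sub>2 in
     if i\<^sub>2 < i then (swap_right j\<^sub>1 j\<^sub>2 M, j\<^sub>2)
     else if \<not> (\<exists>r \<in> snd ` M. min i\<^sub>1 i\<^sub>2 < r \<and> r < max i\<^sub>1 i\<^sub>2) then (M, j\<^sub>2)
     else if i\<^sub>1 < i\<^sub>2 then (M, j\<^sub>1)
     else
       let j\<^sub>3 = next_large i M j\<^sub>1; i\<^sub>3 = left_of M j\<^sub>3
       in ((M - {(i\<^sub>1, j\<^sub>1), (i\<^sub>2, j\<^sub>2), (i\<^sub>3, j\<^sub>3)}) \<union> {(i\<^sub>1, j\<^sub>2), (i\<^sub>2, j\<^sub>3), (i\<^sub>3, j\<^sub>1)}, j\<^sub>2))"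

text \<open>\<open>R\<close> is the set \<open>R\<^sub>1\<close> and \<open>s\<close> the right-hand endpoint of the critical small arc.\<close>

definition algorithm_I :: "nat \<Rightarrow> nat set \<Rightarrow> nat \<Rightarrow> arcs \<Rightarrow> arcs" where
  "algorithm_I i R s M =
     (if R = {} then M
      else fst (fold (step_I i) (rev (sorted_list_of_set {j \<in> R. j < s})) (M, s)))"

definition preprocess_II :: "nat \<Rightarrow> nat \<Rightarrow> arcs \<Rightarrow> arcs" where
  "preprocess_II i t\<^sub>0 M =
     (if i < left_of M t\<^sub>0 then swap_right t\<^sub>0 (next_large i M t\<^sub>0) M else M)"

definition step_II :: "nat \<Rightarrow> nat \<Rightarrow> arcs \<times> nat \<Rightarrow> arcs \<times> nat" where
  "step_II i j\<^sub>2 = (\<lambda>(M, j\<^sub>1).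
     if left_of M j\<^sub>2 < i then (M, j\<^sub>2) else (swap_right j\<^sub>1 j\<^sub>2 M, j\<^sub>2))"

text \<open>\<open>R\<close> is the set of all right-hand endpoints between \<open>i\<close> and \<open>N\<close>, and \<open>R'\<close> is \<open>R\<^sub>2\<close>.\<close>

definition algorithm_II :: "nat \<Rightarrow> nat set \<Rightarrow> nat set \<Rightarrow> arcs \<Rightarrow> arcs" where
  "algorithm_II i R R' M =
     (if R' = {} then M
      else let t\<^sub>0 = Max R'
           in fst (fold (step_II i) (rev (sorted_list_of_set {j \<in> R. j < t\<^sub>0}))
                     (preprocess_II i t\<^sub>0 M, t\<^sub>0)))"

definition transform :: "nat \<Rightarrow> nat \<Rightarrow> arcs \<Rightarrow> arcs" where
  "transform i N M =
     algorithm_II i (right_ends i N M) (R2 i N M)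
       (algorithm_I i (R1 i N M) (snd (critical_small i N M)) M)"

section \<open>The map on matchings and on partitions\<close>

text \<open>Extend a map \<open>f\<close> on matchings of \<open>{1..2m}\<close> to matchings on vertices \<open>a\<^sub>1 < \<dots> < a\<^sub>2\<^sub>m\<close>, identifying
  the vertex \<open>a\<^sub>k\<close> with its rank \<open>k\<close>.\<close>

definition rank :: "nat set \<Rightarrow> nat \<Rightarrow> nat" where
  "rank V v = card {u \<in> V. u \<le> v}"

definition relabelled :: "(arcs \<Rightarrow> arcs) \<Rightarrow> arcs \<Rightarrow> arcs" where
  "relabelled f M =
     (let r = rank (Field M); s = the_inv_into (Field M) r
      in map_prod s s ` f (map_prod r r ` M))"

text \<open>\<open>phi_std m\<close> is the map on matchings of \<open>{1..2m}\<close>.\<close>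

fun phi_std :: "nat \<Rightarrow> arcs \<Rightarrow> arcs" where
  "phi_std 0 = (\<lambda>M. M)"
| "phi_std (Suc 0) = (\<lambda>M. M)"
| "phi_std (Suc (Suc m)) = (\<lambda>M.
     let N = 2 * Suc (Suc m);
         i = left_of M N;
         M\<^sub>1 = M - {(i, N)};
         M\<^sub>1' = relabelled (phi_std (Suc m)) M\<^sub>1
     in transform i N M\<^sub>1' \<union> {(i, N)})"

definition phi_matching :: "arcs \<Rightarrow> arcs" where
  "phi_matching M = relabelled (phi_std (card M)) M"

text \<open>The points \<open>i\<^sup>0 < i\<^sup>1\<close> replacing a vertex \<open>i\<close> are \<open>2i\<close> and \<open>2i + 1\<close>. A vertex which is only a
  right-hand (left-hand) endpoint is not doubled, but is renamed to \<open>2i\<close> (\<open>2i + 1\<close>); as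
  \<open>phi_matching\<close> is defined by ranks, only the order of the names matters.\<close>

definition split_arcs :: "arcs \<Rightarrow> arcs" where
  "split_arcs E = (\<lambda>(i, j). (2 * i + 1, 2 * j)) ` E"

definition merge_arcs :: "arcs \<Rightarrow> arcs" where
  "merge_arcs E = (\<lambda>(a, b). (a div 2, b div 2)) ` E"

definition phi :: "nat set set \<Rightarrow> nat set set" where
  "phi P = partition_of_arcs (\<Union> P) (merge_arcs (phi_matching (split_arcs (block_arcs P))))"

end

theory Submission
  imports Defs "HOL-Combinatorics.Permutations"
begin

text \<open>Passing from a partition to its arcs, splitting vertices, merging them again and passing from arcs
to a partition are injective operations that turn the conditions on the minima and maxima into
conditions on the sets of left-hand and right-hand endpoints. As the sets involved are finite, it
suffices that the map on matchings preserves these two sets of endpoints and is injective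
(\<open>phi_matching_injects\<close>). The recursion keeps the last arc \<open>(i, N)\<close>, so by induction on
the number of arcs everything rests on one step: for fixed \<open>i\<close> and \<open>N\<close>, the map \<open>transform i N\<close> is
injective on matchings with prescribed endpoints (\<open>transform_arc_systems\<close>).

A matching with set \<open>R\<close> of right-hand endpoints is a function \<open>f\<close> sending each \<open>j \<in> R\<close> to its left-hand
endpoint, and the two algorithms only permute the values of \<open>f\<close> at the positions beyond \<open>i\<close>. Let \<open>b\<close> be
the last vertex of \<open>R\<^sub>2\<close>, or \<open>i\<close> if \<open>R\<^sub>2\<close> is empty, and let \<open>c\<close> be the next right-hand endpoint. If the
critical small arc exists, it starts between \<open>b\<close> and \<open>c\<close>, where there is no right-hand endpoint. So, relative
to this gap, a value of \<open>f\<close> is of one of four kinds: large (\<open>< i\<close>), low and small (between \<open>i\<close> and \<open>b\<close>),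
middle (between \<open>b\<close> and \<open>c\<close>), or high (\<open>> c\<close>). Write \<open>L\<close>, \<open>W\<close>, \<open>M\<close> for the first three kinds and read
positions from right to left. The first pointer of Algorithm I always sits at a middle value, high values
are skipped, and on the word of the remaining values the algorithm acts, one letter at a time, by
\<open>X M \<cdot> L \<mapsto> X L M\<close>, \<open>X M \<cdot> M \<mapsto> X M M\<close> and \<open>X L M\<^sup>k \<cdot> W \<mapsto> X W M\<^sup>k\<^sup>-\<^sup>1 L M\<close>.
The result ends in \<open>M\<close>. If the letter before is \<open>M\<close>, the second rule was applied last; otherwise it is \<open>L\<close>,
and the third rule was applied exactly if the nearest letter before it other than \<open>M\<close> is \<open>W\<close>. So each
letter can be taken back (\<open>invariant_I_step\<close>).

Algorithm II changes \<open>L S\<^sup>p L S\<^sup>q \<dots>\<close> into \<open>S\<^sup>p L S\<^sup>q L \<dots>\<close>, where \<open>S\<close> stands for a small value, so it shifts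
a word cyclically and its steps can be taken back too (\<open>step_II_fun_inj\<close>). Its preprocessing exchanges a low
small value at \<open>b\<close> with the nearest low value to the right of \<open>b\<close>, which is large after Algorithm I;
afterwards the kind of that value tells whether the exchange took place (\<open>preprocess_undo\<close>).

It remains to read off the parameters from the result. A small arc that has passed through Algorithm II
has been moved to the right, beyond a right-hand endpoint that it now covers. In contrast, the arc that
ends at the first right-hand endpoint beyond \<open>b\<close> starts beyond \<open>b\<close>, so it covers none. This determines
\<open>b\<close> (\<open>cut_at_unique\<close>), and the critical small arc exists exactly if some arc of the result starts before
\<open>b\<close> and ends beyond it. (All this is about the case in which large arcs end beyond \<open>i\<close>; otherwise nothing
changes.) The starting point of Algorithm I need not be recovered: the algorithm may as well
start at the last position whose value is below \<open>c\<close> (\<open>algorithm_I_fun_from\<close>), and the set of these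
positions never changes.\<close>

section \<open>Sweeping a finite set from right to left\<close>

text \<open>Both algorithms are folds along a decreasing list of vertices. Naming the fold by its underlying set allows
inductions that peel off the smallest element, which is the one visited last.\<close>
definition sweep :: "(nat \<Rightarrow> 's \<Rightarrow> 's) \<Rightarrow> nat set \<Rightarrow> 's \<Rightarrow> 's" where
  "sweep F A st = fold F (rev (sorted_list_of_set A)) st"

lemma sweep_empty [simp]: "sweep F {} st = st"
  by (simp add: sweep_def)

lemma sweep_insert:
  assumes "finite A" and "\<And>a. a \<in> A \<Longrightarrow> q < a"
  shows "sweep F (insert q A) st = F q (sweep F A st)"
proof -
  have "q \<notin> A" using assms(2) by blast
  then have "sorted_list_of_set (insert q A) = q # sorted_list_of_set A"
    using assms by (simp add: insort_is_Cons less_imp_le)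
  then show ?thesis by (simp add: sweep_def)
qed

text \<open>Two sweeps are followed side by side. With \<open>F = G\<close> and an invariant that carries the implication from equal
states to equal inputs, this shows that a sweep of invertible steps is injective; with different \<open>F\<close> and
\<open>G\<close>, it shows that one kind of state simulates another.\<close>
lemma sweep_invariant:
  assumes fin: "finite Q" and s: "s \<in> Q" and start: "K s x y"
    and step: "\<And>p q x y. \<lbrakk>p \<in> Q; q \<in> Q; q < p; p \<le> s; c \<le> q; \<And>k. k \<in> Q \<Longrightarrow> q < k \<Longrightarrow> p \<le> k; K p x y\<rbrakk>
      \<Longrightarrow> K q (F q x) (G q y)"
    and q: "q \<in> Q" "c \<le> q" "q \<le> s"
  shows "K q (sweep F {j \<in> Q. q \<le> j \<and> j < s} x) (sweep G {j \<in> Q. q \<le> j \<and> j < s} y)"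
  using q
proof (induction "card {j \<in> Q. q \<le> j \<and> j < s}" arbitrary: q rule: less_induct)
  case less
  show ?case
  proof (cases "q = s")
    case True
    then have "{j \<in> Q. q \<le> j \<and> j < s} = {}" by auto
    then show ?thesis unfolding True using start by (simp only: sweep_empty)
  next
    case False
    define p where "p = Min {j \<in> Q. q < j}"
    have ne: "{j \<in> Q. q < j} \<noteq> {}" "finite {j \<in> Q. q < j}"
      using False less.prems s fin by auto
    have p: "p \<in> Q" "q < p" using Min_in[OF ne(2,1)] by (auto simp: p_def)
    have next_p: "p \<le> k" if "k \<in> Q" "q < k" for k
      using that ne by (auto simp: p_def)
    have ps: "p \<le> s" using next_p s False less.prems by simp
    have eq: "{j \<in> Q. q \<le> j \<and> j < s} = insert q {j \<in> Q. p \<le> j \<and> j < s}"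
      using less.prems p next_p ps by (auto simp: order_le_less)
    have "card {j \<in> Q. p \<le> j \<and> j < s} < card {j \<in> Q. q \<le> j \<and> j < s}"
      unfolding eq using fin p by (subst card_insert_disjoint) auto
    then have "K p (sweep F {j \<in> Q. p \<le> j \<and> j < s} x) (sweep G {j \<in> Q. p \<le> j \<and> j < s} y)"
      using less.hyps p ps less.prems by auto
    then have "K q (F q (sweep F {j \<in> Q. p \<le> j \<and> j < s} x)) (G q (sweep G {j \<in> Q. p \<le> j \<and> j < s} y))"
      using step[of p q] p ps less.prems next_p by blast
    moreover have "finite {j \<in> Q. p \<le> j \<and> j < s}" "\<And>a. a \<in> {j \<in> Q. p \<le> j \<and> j < s} \<Longrightarrow> q < a"
      using fin p by auto
    note sweep_insert[OF this, of F x] sweep_insert[OF this, of G y]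
    ultimately show ?thesis unfolding eq by (simp only:)
  qed
qed

lemma sweep_union:
  assumes "finite A" "finite B" "\<And>a b. a \<in> A \<Longrightarrow> b \<in> B \<Longrightarrow> a < b"
  shows "sweep F (A \<union> B) st = sweep F A (sweep F B st)"
proof -
  have "sorted_list_of_set (A \<union> B) = sorted_list_of_set A @ sorted_list_of_set B"
    using assms by (intro sorted_distinct_set_unique) (force simp: sorted_append less_imp_le)+
  then show ?thesis by (simp add: sweep_def)
qed

section \<open>Permuting values among positions\<close>

definition rearranges :: "nat set \<Rightarrow> (nat \<Rightarrow> nat) \<Rightarrow> (nat \<Rightarrow> nat) \<Rightarrow> bool" where
  "rearranges Q f g \<longleftrightarrow> (\<exists>\<pi>. \<pi> permutes Q \<and> g = f \<circ> \<pi>)"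

lemma rearranges_refl [simp]: "rearranges Q f f"
  unfolding rearranges_def by (intro exI[of _ id]) (simp add: permutes_id)

lemma rearranges_trans:
  assumes "rearranges Q f g" "rearranges Q g h" shows "rearranges Q f h"
proof -
  obtain \<pi> \<sigma> where "\<pi> permutes Q" "g = f \<circ> \<pi>" "\<sigma> permutes Q" "h = g \<circ> \<sigma>"
    using assms by (auto simp: rearranges_def)
  then show ?thesis unfolding rearranges_def
    by (intro exI[of _ "\<pi> \<circ> \<sigma>"]) (simp add: permutes_compose comp_assoc)
qed

lemma rearranges_swap:
  assumes "x \<in> Q" "y \<in> Q"
  shows "rearranges Q f (f(x := f y, y := f x))"
  unfolding rearranges_def using assms
  by (intro exI[of _ "transpose x y"]) (auto simp: permutes_swap_id fun_eq_iff transpose_def)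

text \<open>The exchange of three right-hand endpoints in Algorithm I.\<close>
lemma rearranges_rotate:
  assumes "x \<in> Q" "y \<in> Q" "z \<in> Q" "x \<noteq> y" "y \<noteq> z" "x \<noteq> z"
  shows "rearranges Q f (f(x := f z, y := f x, z := f y))"
proof -
  let ?g = "f(x := f y, y := f x)"
  have "rearranges Q ?g (?g(x := ?g z, z := ?g x))"
    using assms by (intro rearranges_swap)
  moreover have "?g(x := ?g z, z := ?g x) = f(x := f z, y := f x, z := f y)"
    using assms by (auto simp: fun_eq_iff)
  ultimately show ?thesis using rearranges_trans rearranges_swap assms(1,2) by metis
qed

lemma rearranges_bij_betw:
  assumes "rearranges Q f g" "Q \<subseteq> R" "bij_betw f R L" shows "bij_betw g R L"
proof -
  obtain \<pi> where "\<pi> permutes Q" "g = f \<circ> \<pi>" using assms by (auto simp: rearranges_def)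
  moreover from this have "bij_betw \<pi> R R"
    using assms permutes_subset permutes_imp_bij by blast
  ultimately show ?thesis using assms(3) bij_betw_trans by blast
qed

lemma rearranges_outside:
  assumes "rearranges Q f g" "j \<notin> Q" shows "g j = f j"
  using assms by (auto simp: rearranges_def permutes_not_in)

section \<open>Algorithm II\<close>

text \<open>Here \<open>Q\<close> plays the role of the set of right-hand endpoints beyond \<open>i\<close>. Functions give the left-hand endpoint
of the arc that ends at a position of \<open>Q\<close>; their values elsewhere are never changed.\<close>
locale right_end_set =
  fixes Q :: "nat set" and i :: nat
  assumes finite_Q: "finite Q" and above_i: "q \<in> Q \<Longrightarrow> i < q"
begin

definition valid :: "(nat \<Rightarrow> nat) \<Rightarrow> bool" where
  "valid f \<longleftrightarrow> (\<forall>j\<in>Q. f j < j \<and> f j \<notin> Q \<and> f j \<noteq> i)"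

definition next_large_fun :: "(nat \<Rightarrow> nat) \<Rightarrow> nat \<Rightarrow> nat" where
  "next_large_fun f j = (LEAST k. j < k \<and> k \<in> Q \<and> f k < i)"

text \<open>The operations \<open>step_II\<close>, \<open>preprocess_II\<close> and \<open>algorithm_II\<close>, acting on functions in place of sets of
arcs.\<close>
definition step_II_fun :: "nat \<Rightarrow> (nat \<Rightarrow> nat) \<times> nat \<Rightarrow> (nat \<Rightarrow> nat) \<times> nat" where
  "step_II_fun j\<^sub>2 = (\<lambda>(f, j\<^sub>1). if f j\<^sub>2 < i then (f, j\<^sub>2) else (f(j\<^sub>1 := f j\<^sub>2, j\<^sub>2 := f j\<^sub>1), j\<^sub>2))"

definition preprocess_fun :: "nat \<Rightarrow> (nat \<Rightarrow> nat) \<Rightarrow> (nat \<Rightarrow> nat)" where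
  "preprocess_fun t f = (if i < f t then f(t := f (next_large_fun f t), next_large_fun f t := f t) else f)"

definition algorithm_II_fun :: "nat \<Rightarrow> (nat \<Rightarrow> nat) \<Rightarrow> (nat \<Rightarrow> nat)" where
  "algorithm_II_fun t f = fst (sweep step_II_fun {j \<in> Q. j < t} (preprocess_fun t f, t))"

text \<open>The state of Algorithm II after position \<open>p\<close>, started at \<open>t\<close> from the function \<open>f0\<close>: the pointer is at a
large arc, and every small arc at a position passed already covers a right-hand endpoint. The last property
survives the algorithm and marks the range in which it has worked.\<close>
definition invariant_II :: "nat \<Rightarrow> (nat \<Rightarrow> nat) \<Rightarrow> nat \<Rightarrow> (nat \<Rightarrow> nat) \<times> nat \<Rightarrow> bool" where
  "invariant_II t f0 p = (\<lambda>(f, j). j = p \<and> f p < i \<and> valid f \<and> rearranges Q f0 f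
     \<and> (\<forall>k. t < k \<longrightarrow> f k = f0 k)
     \<and> (\<forall>k\<in>Q. p < k \<and> k \<le> t \<longrightarrow> f k < i \<or> (\<exists>r\<in>Q. f k < r \<and> r < k)))"

text \<open>A small arc at \<open>q\<close> moves to the previous position \<open>p > q\<close>, so from then on it covers \<open>q\<close>.\<close>
lemma invariant_II_step:
  assumes "p \<in> Q" "q \<in> Q" "q < p" "p \<le> t" and next_p: "\<And>k. k \<in> Q \<Longrightarrow> q < k \<Longrightarrow> p \<le> k"
    and "invariant_II t f0 p x"
  shows "invariant_II t f0 q (step_II_fun q x)"
proof -
  obtain f where x: "x = (f, p)" and f: "f p < i" "valid f" "rearranges Q f0 f"
     "\<forall>k. t < k \<longrightarrow> f k = f0 k"
     "\<forall>k\<in>Q. p < k \<and> k \<le> t \<longrightarrow> f k < i \<or> (\<exists>r\<in>Q. f k < r \<and> r < k)"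
    using assms(6) by (auto simp: invariant_II_def)
  have q: "f q < q" "f q \<notin> Q" "f q \<noteq> i" using f(2) assms(2) by (auto simp: valid_def)
  have iq: "i < q" using above_i assms by simp
  show ?thesis
  proof (cases "f q < i")
    case True
    have "f k < i \<or> (\<exists>r\<in>Q. f k < r \<and> r < k)" if "k \<in> Q" "q < k" "k \<le> t" for k
      using f(1,5) next_p[OF that(1,2)] that by (cases "k = p") auto
    then show ?thesis using True f by (auto simp: x step_II_fun_def invariant_II_def)
  next
    case False
    let ?g = "f(p := f q, q := f p)"
    have "valid ?g" using f(1,2) assms(1-3) q iq by (auto simp: valid_def)
    moreover have "rearranges Q f0 ?g"
      using rearranges_trans[OF f(3) rearranges_swap] assms(1,2) by blast
    moreover have "?g k < i \<or> (\<exists>r\<in>Q. ?g k < r \<and> r < k)" if "k \<in> Q" "q < k" "k \<le> t" for k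
      using f(5) next_p[OF that(1,2)] that assms(2,3) q by (cases "k = p") auto
    ultimately show ?thesis using False f(1,4) assms(3,4) by (auto simp: x step_II_fun_def invariant_II_def)
  qed
qed

text \<open>Before the step the arc at \<open>p\<close> is large. So an exchange has taken place exactly if the arc at \<open>p\<close> is small
afterwards.\<close>
lemma step_II_fun_inj:
  assumes "q < p" "invariant_II t f0 p x" "invariant_II t g0 p y" "step_II_fun q x = step_II_fun q y"
  shows "x = y"
proof -
  obtain f g where x: "x = (f, p)" "y = (g, p)" and fg: "f p < i" "g p < i"
    using assms by (auto simp: invariant_II_def)
  have undo: "h = (if h' p < i then h' else h'(p := h' q, q := h' p))"
    if "step_II_fun q (h, p) = (h', q)" "h p < i" for h h'
    using that assms(1) by (auto simp: step_II_fun_def split: if_splits)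
  show ?thesis
    using undo[of f "fst (step_II_fun q x)"] undo[of g "fst (step_II_fun q x)"] assms(4) fg x
    by (auto simp: step_II_fun_def split: if_splits)
qed

lemma next_large_fun_props:
  assumes "t \<in> Q" "\<exists>j\<in>Q. t < j \<and> f j < i"
  shows "next_large_fun f t \<in> Q" "t < next_large_fun f t" "f (next_large_fun f t) < i"
    "\<And>k. k \<in> Q \<Longrightarrow> t < k \<Longrightarrow> f k < i \<Longrightarrow> next_large_fun f t \<le> k"
proof -
  let ?P = "\<lambda>k. t < k \<and> k \<in> Q \<and> f k < i"
  have "?P (next_large_fun f t)" unfolding next_large_fun_def using assms(2) by (intro LeastI_ex[of ?P]) blast
  then show "next_large_fun f t \<in> Q" "t < next_large_fun f t" "f (next_large_fun f t) < i" by auto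
  show "next_large_fun f t \<le> k" if "k \<in> Q" "t < k" "f k < i" for k
    unfolding next_large_fun_def using that by (intro Least_le[of ?P]) simp
qed

text \<open>Preprocessing brings a large arc to \<open>t\<close>, where the sweep starts.\<close>
lemma algorithm_II_fun_start:
  assumes "t \<in> Q" "valid f" and ex: "\<exists>j\<in>Q. t \<le> j \<and> f j < i"
  shows "invariant_II t (preprocess_fun t f) t (preprocess_fun t f, t)" "rearranges Q f (preprocess_fun t f)"
proof -
  have above: "\<exists>j\<in>Q. t < j \<and> f j < i" if "i < f t"
  proof -
    obtain j where "j \<in> Q" "t \<le> j" "f j < i" using ex by blast
    moreover from this have "j \<noteq> t" using that by auto
    ultimately show ?thesis by (intro bexI[of _ j]) simp_all
  qed
  show "rearranges Q f (preprocess_fun t f)"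
  proof (cases "i < f t")
    case True
    show ?thesis
      using rearranges_swap[OF assms(1) next_large_fun_props(1)[OF assms(1) above[OF True]]] True
      by (simp add: preprocess_fun_def)
  qed (simp add: preprocess_fun_def)
  show "invariant_II t (preprocess_fun t f) t (preprocess_fun t f, t)"
  proof (cases "i < f t")
    case True
    define l where "l = next_large_fun f t"
    note l = next_large_fun_props[OF assms(1) above[OF True], folded l_def]
    have eq: "preprocess_fun t f = f(t := f l, l := f t)" using True by (simp add: preprocess_fun_def l_def)
    have "i < t" using above_i assms(1) .
    then have "valid (preprocess_fun t f)"
      using True assms(1,2) l(1-3) unfolding eq by (auto simp: valid_def)
    moreover have "preprocess_fun t f t < i" using l unfolding eq by simp
    ultimately show ?thesis by (simp add: invariant_II_def)
  next
    case False
    moreover have "f t \<noteq> i" using assms by (auto simp: valid_def)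
    ultimately show ?thesis using assms(2) by (simp add: invariant_II_def preprocess_fun_def)
  qed
qed

lemma algorithm_II_fun_range_eq:
  "{j \<in> Q. j < t} = {j \<in> Q. Min Q \<le> j \<and> j < t}"
  using finite_Q by auto

lemma Min_right_end: "t \<in> Q \<Longrightarrow> Min Q \<in> Q" "t \<in> Q \<Longrightarrow> Min Q \<le> t"
  by (rule Min_in[OF finite_Q], blast) (rule Min_le[OF finite_Q])

lemma algorithm_II_fun_result:
  assumes "t \<in> Q" "valid f" and ex: "\<exists>j\<in>Q. t \<le> j \<and> f j < i"
  shows "invariant_II t (preprocess_fun t f) (Min Q) (algorithm_II_fun t f, Min Q)"
proof -
  define K where "K p x (y :: (nat \<Rightarrow> nat) \<times> nat) \<longleftrightarrow> invariant_II t (preprocess_fun t f) p x" for p x y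
  let ?z = "sweep step_II_fun {j \<in> Q. j < t} (preprocess_fun t f, t)"
  have "K (Min Q) ?z ?z"
    unfolding algorithm_II_fun_range_eq
    using finite_Q assms(1)
  proof (rule sweep_invariant[where K = K and c = "Min Q"])
    show "K t (preprocess_fun t f, t) (preprocess_fun t f, t)" using algorithm_II_fun_start assms by (simp add: K_def)
    show "K q (step_II_fun q x) (step_II_fun q y)" if "p \<in> Q" "q \<in> Q" "q < p" "p \<le> t" "Min Q \<le> q"
      "\<And>k. k \<in> Q \<Longrightarrow> q < k \<Longrightarrow> p \<le> k" "K p x y" for p q x y
      using invariant_II_step[OF that(1-4,6)] that(7) by (simp add: K_def)
  qed (use Min_right_end[OF assms(1)] in auto)
  then have "invariant_II t (preprocess_fun t f) (Min Q) ?z" by (simp add: K_def)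
  then show ?thesis unfolding algorithm_II_fun_def by (auto simp: invariant_II_def split: prod.splits)
qed

text \<open>All steps can be taken back, but not yet the preprocessing: this needs knowledge about the positions beyond
\<open>t\<close>.\<close>
lemma algorithm_II_fun_inj:
  assumes "t \<in> Q" "valid f" "\<exists>j\<in>Q. t \<le> j \<and> f j < i" "valid g" "\<exists>j\<in>Q. t \<le> j \<and> g j < i"
    and eq: "algorithm_II_fun t f = algorithm_II_fun t g"
  shows "preprocess_fun t f = preprocess_fun t g"
proof -
  define K where "K p x y \<longleftrightarrow> invariant_II t (preprocess_fun t f) p x \<and> invariant_II t (preprocess_fun t g) p y
    \<and> (x = y \<longrightarrow> preprocess_fun t f = preprocess_fun t g)" for p x y
  let ?z = "\<lambda>f. sweep step_II_fun {j \<in> Q. j < t} (preprocess_fun t f, t)"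
  have "K (Min Q) (?z f) (?z g)"
    unfolding algorithm_II_fun_range_eq
    using finite_Q assms(1)
  proof (rule sweep_invariant[where K = K and c = "Min Q"])
    show "K t (preprocess_fun t f, t) (preprocess_fun t g, t)" using algorithm_II_fun_start assms by (simp add: K_def)
    show "K q (step_II_fun q x) (step_II_fun q y)" if "p \<in> Q" "q \<in> Q" "q < p" "p \<le> t" "Min Q \<le> q"
      "\<And>k. k \<in> Q \<Longrightarrow> q < k \<Longrightarrow> p \<le> k" "K p x y" for p q x y
      using invariant_II_step[OF that(1-4,6)] step_II_fun_inj[OF that(3)] that(7) unfolding K_def by blast
  qed (use Min_right_end[OF assms(1)] in auto)
  moreover have "snd (?z f) = Min Q" "snd (?z g) = Min Q"
    using calculation by (auto simp: K_def invariant_II_def)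
  ultimately show ?thesis using eq unfolding algorithm_II_fun_def K_def by (metis prod.collapse)
qed

text \<open>The mark left by the algorithms on their result: \<open>b\<close> is the last position that Algorithm II has worked on, or
\<open>i\<close> if it has done nothing. Up to \<open>b\<close> every small arc covers a right-hand endpoint, whereas the arc that ends
at the first position beyond \<open>b\<close> starts beyond \<open>b\<close>.\<close>
definition cut_at :: "(nat \<Rightarrow> nat) \<Rightarrow> nat \<Rightarrow> bool" where
  "cut_at g b \<longleftrightarrow> (b = i \<or> b \<in> Q) \<and> (\<exists>j\<in>Q. g j < i)
     \<and> (\<forall>j\<in>Q. j \<le> b \<longrightarrow> g j < i \<or> (\<exists>r\<in>Q. g j < r \<and> r < j))
     \<and> (\<forall>j\<in>Q. b < j \<and> (\<forall>k\<in>Q. b < k \<longrightarrow> j \<le> k) \<longrightarrow> b < g j)"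

text \<open>If \<open>b < b'\<close>, then the arc at the first position beyond \<open>b\<close> is small and covers no right-hand endpoint, although
its position is at most \<open>b'\<close>.\<close>
lemma cut_at_not_less:
  assumes "cut_at g b" "cut_at g b'" shows "\<not> b < b'"
proof
  assume "b < b'"
  have ib: "i \<le> b" using assms(1) above_i by (auto simp: cut_at_def intro: less_imp_le)
  define j where "j = Min {j \<in> Q. b < j}"
  have "b' \<in> Q" using assms(2) \<open>b < b'\<close> ib by (auto simp: cut_at_def)
  then have ne: "{j \<in> Q. b < j} \<noteq> {}" "finite {j \<in> Q. b < j}" using \<open>b < b'\<close> finite_Q by auto
  have j: "j \<in> Q" "b < j" using Min_in[OF ne(2,1)] by (auto simp: j_def)
  have least: "j \<le> k" if "k \<in> Q" "b < k" for k using that ne by (auto simp: j_def)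
  have "b < g j" using assms(1) j least unfolding cut_at_def by blast
  moreover have "j \<le> b'" using least \<open>b' \<in> Q\<close> \<open>b < b'\<close> by blast
  then have "g j < i \<or> (\<exists>r\<in>Q. g j < r \<and> r < j)" using assms(2) j unfolding cut_at_def by blast
  ultimately obtain r where r: "r \<in> Q" "g j < r" "r < j" using ib by auto
  then have "b < r" using \<open>b < g j\<close> by simp
  then show False using least[OF r(1)] r(3) by simp
qed

lemma cut_at_unique: "cut_at g b \<Longrightarrow> cut_at g b' \<Longrightarrow> b = b'"
  using cut_at_not_less by (meson linorder_neqE_nat)

lemma algorithm_II_fun_props:
  assumes "t \<in> Q" "valid f" and ex: "\<exists>j\<in>Q. t \<le> j \<and> f j < i"
  shows "valid (algorithm_II_fun t f)" "rearranges Q f (algorithm_II_fun t f)"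
    "\<And>k. t < k \<Longrightarrow> algorithm_II_fun t f k = preprocess_fun t f k"
    "\<exists>j\<in>Q. algorithm_II_fun t f j < i"
    "\<And>j. j \<in> Q \<Longrightarrow> j \<le> t \<Longrightarrow> algorithm_II_fun t f j < i \<or> (\<exists>r\<in>Q. algorithm_II_fun t f j < r \<and> r < j)"
proof -
  let ?g = "algorithm_II_fun t f"
  have res: "?g (Min Q) < i" "valid ?g" "rearranges Q (preprocess_fun t f) ?g" "\<forall>k. t < k \<longrightarrow> ?g k = preprocess_fun t f k"
     "\<forall>k\<in>Q. Min Q < k \<and> k \<le> t \<longrightarrow> ?g k < i \<or> (\<exists>r\<in>Q. ?g k < r \<and> r < k)"
    using algorithm_II_fun_result[OF assms] unfolding invariant_II_def prod.case by blast+
  show "valid ?g" by fact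
  show "rearranges Q f ?g" using rearranges_trans algorithm_II_fun_start(2)[OF assms] res(3) by blast
  show "?g k = preprocess_fun t f k" if "t < k" for k using res(4) that by blast
  show "\<exists>j\<in>Q. ?g j < i" using Min_right_end(1)[OF assms(1)] res(1) by blast
  show "?g j < i \<or> (\<exists>r\<in>Q. ?g j < r \<and> r < j)" if "j \<in> Q" "j \<le> t" for j
  proof (cases "j = Min Q")
    case False
    then have "Min Q < j" using Min_right_end(2)[OF that(1)] by simp
    then show ?thesis using res(5) that by blast
  qed (use res(1) in simp)
qed

text \<open>The critical large arc exists and ends at \<open>t\<close>, and no small arc crosses it: then every arc that ends beyond
\<open>t\<close> starts beyond \<open>t\<close>.\<close>
definition uncrossed :: "nat \<Rightarrow> (nat \<Rightarrow> nat) \<Rightarrow> bool" where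
  "uncrossed t f \<longleftrightarrow> t \<in> Q \<and> valid f \<and> f t < i \<and> (\<forall>j\<in>Q. t < j \<longrightarrow> t < f j)"

lemma uncrossed_result:
  assumes "uncrossed t f"
  shows "cut_at (algorithm_II_fun t f) t" "\<forall>j\<in>Q. t < j \<longrightarrow> t < algorithm_II_fun t f j"
    "preprocess_fun t f = f" "valid (algorithm_II_fun t f)" "rearranges Q f (algorithm_II_fun t f)"
proof -
  have f: "t \<in> Q" "valid f" "f t < i" "\<forall>j\<in>Q. t < j \<longrightarrow> t < f j"
    using assms by (auto simp: uncrossed_def)
  then have ex: "\<exists>j\<in>Q. t \<le> j \<and> f j < i" by blast
  show preprocess_fun: "preprocess_fun t f = f" using f(3) by (simp add: preprocess_fun_def)
  note g = algorithm_II_fun_props[OF f(1,2) ex, unfolded preprocess_fun]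
  show "valid (algorithm_II_fun t f)" "rearranges Q f (algorithm_II_fun t f)" by (fact g)+
  show *: "\<forall>j\<in>Q. t < j \<longrightarrow> t < algorithm_II_fun t f j" using f(4) g(3) by simp
  show "cut_at (algorithm_II_fun t f) t" unfolding cut_at_def using f(1) g(4,5) * by blast
qed

end

section \<open>Algorithm I\<close>

text \<open>The gap between two neighbouring positions that contains the left-hand endpoint of the critical small arc.
Values below \<open>b\<close> are called low, and they are large or small. Values between \<open>b\<close> and \<open>c\<close> are exactly the
left-hand endpoints that no right-hand endpoint separates from that of the critical small arc.\<close>
locale window = right_end_set +
  fixes b c :: nat
  assumes b: "b = i \<or> b \<in> Q" and c: "c \<in> Q" and b_less_c: "b < c"
    and adjacent: "q \<in> Q \<Longrightarrow> b < q \<Longrightarrow> c \<le> q"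
begin

lemma i_le_b: "i \<le> b" using b above_i by (auto intro: less_imp_le)

text \<open>The operation \<open>step_I\<close> on functions, provided that the value at the first pointer lies between \<open>b\<close> and \<open>c\<close>.
Under this condition the three cases for small arcs depend only on the place of the value \<open>f j\<^sub>2\<close> relative to
\<open>b\<close> and \<open>c\<close>.\<close>
definition step_I_fun :: "nat \<Rightarrow> (nat \<Rightarrow> nat) \<times> nat \<Rightarrow> (nat \<Rightarrow> nat) \<times> nat" where
  "step_I_fun j\<^sub>2 = (\<lambda>(f, j\<^sub>1).
     if f j\<^sub>2 < i then (f(j\<^sub>1 := f j\<^sub>2, j\<^sub>2 := f j\<^sub>1), j\<^sub>2)
     else if f j\<^sub>2 < b then
       (let j\<^sub>3 = next_large_fun f j\<^sub>1 in (f(j\<^sub>1 := f j\<^sub>3, j\<^sub>2 := f j\<^sub>1, j\<^sub>3 := f j\<^sub>2), j\<^sub>2))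
     else if f j\<^sub>2 < c then (f, j\<^sub>2) else (f, j\<^sub>1))"

definition next_below :: "(nat \<Rightarrow> nat) \<Rightarrow> nat \<Rightarrow> nat \<Rightarrow> nat" where
  "next_below f v j = (LEAST k. j < k \<and> k \<in> Q \<and> f k < v)"

lemma next_below_eqI:
  assumes "k \<in> Q" "j < k" "f k < v" "\<And>l. l \<in> Q \<Longrightarrow> j < l \<Longrightarrow> l < k \<Longrightarrow> v \<le> f l"
  shows "next_below f v j = k"
  unfolding next_below_def using assms by (intro Least_equality) (auto simp: not_less[symmetric])

text \<open>The inverse of the step at \<open>q\<close>. A first pointer different from \<open>q\<close> means that \<open>q\<close> was skipped. Otherwise the
previous pointer \<open>j\<^sub>1\<close> is the next position above \<open>q\<close> that was not skipped. If it is left with a middle value,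
the pointer has just moved. If it is left with a large value, then the nearest low value above \<open>j\<^sub>1\<close> is small
exactly if three arcs were rotated.\<close>
definition undo_step_I :: "nat \<Rightarrow> (nat \<Rightarrow> nat) \<times> nat \<Rightarrow> (nat \<Rightarrow> nat) \<times> nat" where
  "undo_step_I q = (\<lambda>(f, j). if j \<noteq> q then (f, j) else
     let j\<^sub>1 = next_below f c q in
     if b < f j\<^sub>1 then (f, j\<^sub>1) else
     let j\<^sub>3 = next_below f b j\<^sub>1 in
     if (\<exists>j\<in>Q. j\<^sub>1 < j \<and> f j < b) \<and> i < f j\<^sub>3 then (f(j\<^sub>1 := f q, q := f j\<^sub>3, j\<^sub>3 := f j\<^sub>1), j\<^sub>1)
     else (f(j\<^sub>1 := f q, q := f j\<^sub>1), j\<^sub>1))"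

text \<open>The first low value beyond the pointer is large, if there is one. Hence the next large arc beyond the pointer,
which is used by the rotation, is at the same time the next low one.\<close>
definition first_low_large :: "(nat \<Rightarrow> nat) \<Rightarrow> nat \<Rightarrow> bool" where
  "first_low_large f j \<longleftrightarrow>
    (\<forall>k\<in>Q. j < k \<and> f k < b \<and> (\<forall>l\<in>Q. j < l \<and> l < k \<longrightarrow> b \<le> f l) \<longrightarrow> f k < i)"

text \<open>The state of Algorithm I after position \<open>p\<close>, started from \<open>f0\<close>. The last condition provides the large arc
needed by each rotation still to come.\<close>
definition invariant_I :: "(nat \<Rightarrow> nat) \<Rightarrow> nat \<Rightarrow> (nat \<Rightarrow> nat) \<times> nat \<Rightarrow> bool" where
  "invariant_I f0 p = (\<lambda>(f, j\<^sub>1). j\<^sub>1 \<in> Q \<and> p \<le> j\<^sub>1 \<and> b < f j\<^sub>1 \<and> f j\<^sub>1 < c \<and> valid f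
     \<and> rearranges Q f0 f \<and> (\<forall>k<p. f k = f0 k) \<and> (\<forall>k. f k < c \<longleftrightarrow> f0 k < c)
     \<and> (\<forall>k\<in>Q. p \<le> k \<and> k < j\<^sub>1 \<longrightarrow> c < f k)
     \<and> first_low_large f j\<^sub>1
     \<and> (\<exists>k\<in>Q. b < k \<and> f k < i)
     \<and> (\<forall>w\<in>Q. w < p \<and> i < f w \<and> f w < b \<longrightarrow> (\<exists>k\<in>Q. w < k \<and> f k < i)))"

lemma next_below_props:
  assumes "\<exists>k\<in>Q. j < k \<and> f k < v"
  shows "next_below f v j \<in> Q" "j < next_below f v j" "f (next_below f v j) < v"
    "\<And>k. k \<in> Q \<Longrightarrow> j < k \<Longrightarrow> k < next_below f v j \<Longrightarrow> v \<le> f k"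
proof -
  let ?P = "\<lambda>k. j < k \<and> k \<in> Q \<and> f k < v"
  have "?P (next_below f v j)" unfolding next_below_def using assms by (intro LeastI_ex[of ?P]) blast
  then show "next_below f v j \<in> Q" "j < next_below f v j" "f (next_below f v j) < v" by auto
  show "v \<le> f k" if "k \<in> Q" "j < k" "k < next_below f v j" for k
    using not_less_Least[of k ?P] that unfolding next_below_def by (simp add: not_less)
qed

lemma invariant_I_intro:
  assumes "j \<in> Q" "q \<le> j" "b < f j" "f j < c" "valid f" "rearranges Q f0 f"
    "\<And>k. k < q \<Longrightarrow> f k = f0 k" "\<And>k. f k < c \<longleftrightarrow> f0 k < c"
    "\<And>k. k \<in> Q \<Longrightarrow> q \<le> k \<Longrightarrow> k < j \<Longrightarrow> c < f k"
    "first_low_large f j" "\<exists>k\<in>Q. b < k \<and> f k < i"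
    "\<And>w. w\<in>Q \<Longrightarrow> w < q \<Longrightarrow> i < f w \<Longrightarrow> f w < b \<Longrightarrow> \<exists>k\<in>Q. w < k \<and> f k < i"
  shows "invariant_I f0 q (f, j)"
  unfolding invariant_I_def prod.case using assms by blast

lemma invariant_I_next_large:
  assumes "q \<in> Q" "q < p" and next_p: "\<And>k. k \<in> Q \<Longrightarrow> q < k \<Longrightarrow> p \<le> k"
    and inv: "invariant_I f0 p (f, j)" and W: "i < f q" "f q < b"
  shows "\<exists>k\<in>Q. j < k \<and> f k < i"
proof -
  have f: "b < f j" "\<And>k. k \<in> Q \<Longrightarrow> p \<le> k \<Longrightarrow> k < j \<Longrightarrow> c < f k"
     "\<And>w. w\<in>Q \<Longrightarrow> w < p \<Longrightarrow> i < f w \<Longrightarrow> f w < b \<Longrightarrow> \<exists>k\<in>Q. w < k \<and> f k < i"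
    using inv unfolding invariant_I_def prod.case by blast+
  obtain k where k: "k \<in> Q" "q < k" "f k < i" using f(3)[OF assms(1,2) W] by blast
  have "\<not> k < j"
    using f(2)[OF k(1) next_p[OF k(1,2)]] k(3) i_le_b b_less_c by auto
  moreover have "k \<noteq> j" using k(3) f(1) i_le_b by auto
  ultimately show ?thesis using k by (intro bexI[of _ k]) auto
qed

text \<open>The four cases are the four kinds of the value at \<open>q\<close>. Each time the pointer keeps its middle value, and in the
two cases that change the function a large value is left behind at the old pointer \<open>j\<close>, directly before
the new one up to high values; this re-establishes \<open>first_low_large\<close>.\<close>
lemma invariant_I_step:
  assumes pq: "p \<in> Q" "q \<in> Q" "q < p" "c \<le> q" and next_p: "\<And>k. k \<in> Q \<Longrightarrow> q < k \<Longrightarrow> p \<le> k"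
    and inv: "invariant_I f0 p x"
  shows "invariant_I f0 q (step_I_fun q x)" and "undo_step_I q (step_I_fun q x) = x"
proof -
  obtain f j where x: "x = (f, j)" by (cases x)
  have f: "j \<in> Q" "p \<le> j" "b < f j" "f j < c" "valid f" "rearranges Q f0 f" "\<And>k. k < p \<Longrightarrow> f k = f0 k"
     "\<And>k. f k < c \<longleftrightarrow> f0 k < c"
     "\<And>k. k \<in> Q \<Longrightarrow> p \<le> k \<Longrightarrow> k < j \<Longrightarrow> c < f k" "first_low_large f j" "\<exists>k\<in>Q. b < k \<and> f k < i"
     "\<And>w. w\<in>Q \<Longrightarrow> w < p \<Longrightarrow> i < f w \<Longrightarrow> f w < b \<Longrightarrow> \<exists>k\<in>Q. w < k \<and> f k < i"
    using inv unfolding invariant_I_def x prod.case by blast+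
  have between: "c < f k" if "k \<in> Q" "q < k" "k < j" for k
    using f(9) next_p that by blast
  have qj: "q < j" using f pq by simp
  have fq: "f q < q" "f q \<notin> Q" "f q \<noteq> i" using f(5) pq by (auto simp: valid_def)
  then have fq': "f q \<noteq> b" "f q \<noteq> c" using b c by auto
  have iq: "i < q" using above_i pq by simp
  have bq: "b < q" using pq b_less_c by simp
  consider (L) "f q < i" | (W) "i < f q" "f q < b" | (G) "b < f q" "f q < c" | (H) "c < f q"
    using fq fq' by linarith
  then have "invariant_I f0 q (step_I_fun q x) \<and> undo_step_I q (step_I_fun q x) = x"
  proof cases
    case L
    let ?g = "f(j := f q, q := f j)"
    have step: "step_I_fun q x = (?g, q)" using L by (simp add: step_I_fun_def x)
    have valid: "valid ?g" using f(1,2,4,5) fq pq qj by (auto simp: valid_def)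
    have rearr: "rearranges Q f0 ?g" using rearranges_trans[OF f(6) rearranges_swap] f(1) pq by blast
    have low: "first_low_large ?g q"
      unfolding first_low_large_def
    proof (intro ballI impI, elim conjE)
      fix k assume k: "k \<in> Q" "q < k" "?g k < b" "\<forall>l\<in>Q. q < l \<and> l < k \<longrightarrow> b \<le> ?g l"
      have "k \<le> j"
      proof (rule ccontr)
        assume "\<not> k \<le> j"
        then have "b \<le> ?g j" using k(4) f(1) qj by auto
        then show False using L i_le_b qj by simp
      qed
      then show "?g k < i" using between[OF k(1,2)] k(2,3) L b_less_c by (cases "k = j") auto
    qed
    have inv': "invariant_I f0 q (?g, q)"
    proof (rule invariant_I_intro)
      show "q \<in> Q" "q \<le> q" "b < ?g q" "?g q < c" "rearranges Q f0 ?g" "first_low_large ?g q"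
        using pq f(3,4) rearr low by simp_all
      show "valid ?g" by fact
      show "?g k = f0 k" if "k < q" for k using that qj pq f(7) by simp
      show "?g k < c \<longleftrightarrow> f0 k < c" for k
        using f(4) f(8)[of k] f(8)[of q] f(8)[of j] L i_le_b b_less_c by simp
      show "c < ?g k" if "q \<le> k" "k < q" for k using that by simp
      show "\<exists>k\<in>Q. b < k \<and> ?g k < i" using f(1) L qj bq by (intro bexI[of _ j]) simp_all
      show "\<exists>k\<in>Q. w < k \<and> ?g k < i" if "w < q" for w
        using f(1) L qj that by (intro bexI[of _ j]) simp_all
    qed
    have nb: "next_below ?g c q = j"
    proof (rule next_below_eqI)
      show "c \<le> ?g k" if "k \<in> Q" "q < k" "k < j" for k
        using between[OF that] that by simp
    qed (use f(1) qj L b_less_c i_le_b in simp_all)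
    \<comment> \<open>Beyond \<open>j\<close> nothing has changed, so the first low value there is still large: no sign of a rotation.\<close>
    have nb': "\<not> ((\<exists>k\<in>Q. j < k \<and> ?g k < b) \<and> i < ?g (next_below ?g b j))"
    proof
      let ?l = "next_below ?g b j"
      assume *: "(\<exists>k\<in>Q. j < k \<and> ?g k < b) \<and> i < ?g ?l"
      note l = next_below_props[of j ?g b, OF conjunct1[OF *]]
      have "b \<le> f m" if "m \<in> Q" "j < m" "m < ?l" for m
        using l(4)[OF that] that qj by simp
      moreover have "f ?l < b" using l(2,3) qj by simp
      ultimately have "f ?l < i" using f(10) l(1,2) unfolding first_low_large_def by blast
      then show False using * l(2) qj by simp
    qed
    have "undo_step_I q (?g, q) = (f, j)"
      unfolding undo_step_I_def prod.case nb Let_def if_not_P[OF nb'] using L i_le_b qj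
      by (simp add: fun_eq_iff)
    then show ?thesis using inv' step x by simp
  next
    case W
    define l where "l = next_large_fun f j"
    have "\<exists>k\<in>Q. j < k \<and> f k < i" using invariant_I_next_large pq next_p inv W unfolding x by blast
    note l = next_large_fun_props[OF f(1) this, folded l_def]
    \<comment> \<open>The next large position is also the next low one, so after the rotation the first low value beyond
      \<open>j\<close> is the small one now at \<open>l\<close>.\<close>
    have above: "b \<le> f k" if "k \<in> Q" "j < k" "k < l" for k
    proof (rule ccontr)
      assume "\<not> b \<le> f k"
      then have "\<exists>k\<in>Q. j < k \<and> f k < b" using that by (meson not_le)
      note m = next_below_props[OF this]
      have "next_below f b j \<le> k" using m(4)[OF that(1,2)] \<open>\<not> b \<le> f k\<close> by (meson not_le)
      moreover have "f (next_below f b j) < i"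
        using f(10) m unfolding first_low_large_def by blast
      ultimately show False using l(4)[OF m(1,2)] that(3) by simp
    qed
    let ?g = "f(j := f l, q := f j, l := f q)"
    have step: "step_I_fun q x = (?g, q)" using W by (simp add: step_I_fun_def x l_def Let_def)
    have valid: "valid ?g" using f(1,2,4,5) fq pq qj l above_i[of j] by (auto simp: valid_def)
    have rearr: "rearranges Q f0 ?g"
    proof (rule rearranges_trans[OF f(6)], rule rearranges_rotate)
    qed (use f(1) pq(2) l(1,2) qj in simp_all)
    have low: "first_low_large ?g q"
      unfolding first_low_large_def
    proof (intro ballI impI, elim conjE)
      fix k assume k: "k \<in> Q" "q < k" "?g k < b" "\<forall>l\<in>Q. q < l \<and> l < k \<longrightarrow> b \<le> ?g l"
      have "k \<le> j"
      proof (rule ccontr)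
        assume "\<not> k \<le> j"
        then have "b \<le> ?g j" using k(4) f(1) qj by auto
        then show False using l i_le_b qj by auto
      qed
      then show "?g k < i" using between[OF k(1,2)] k(2,3) l b_less_c by (cases "k = j") auto
    qed
    have jb: "b < j" using bq qj by simp
    have ex: "\<exists>k\<in>Q. w < k \<and> ?g k < i" if "w < j" for w
      using f(1) that l qj by (intro bexI[of _ j]) auto
    have inv': "invariant_I f0 q (?g, q)"
    proof (rule invariant_I_intro)
      show "q \<in> Q" "q \<le> q" "b < ?g q" "?g q < c" "rearranges Q f0 ?g" "first_low_large ?g q"
        using pq f(3,4) rearr low l(2) qj by simp_all
      show "valid ?g" by fact
      show "?g k = f0 k" if "k < q" for k using that qj pq l(2) f(7) by simp
      show "?g k < c \<longleftrightarrow> f0 k < c" for k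
        using f(4) f(8)[of k] f(8)[of q] f(8)[of j] f(8)[of l] l(3) W i_le_b b_less_c by simp
      show "c < ?g k" if "q \<le> k" "k < q" for k using that by simp
      show "\<exists>k\<in>Q. b < k \<and> ?g k < i" using ex[OF jb] .
      show "\<exists>k\<in>Q. w < k \<and> ?g k < i" if "w < q" for w using ex[of w] qj that by simp
    qed
    have nb: "next_below ?g c q = j"
    proof (rule next_below_eqI)
      show "c \<le> ?g k" if "k \<in> Q" "q < k" "k < j" for k
        using between[OF that] that l(2) by simp
    qed (use f(1) qj l(2,3) b_less_c i_le_b in simp_all)
    have nb': "next_below ?g b j = l"
    proof (rule next_below_eqI)
      show "b \<le> ?g k" if "k \<in> Q" "j < k" "k < l" for k
        using above[OF that] that qj by simp
    qed (use l(1,2) W in simp_all)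
    have ex': "\<exists>k\<in>Q. j < k \<and> ?g k < b" using W l by (intro bexI[of _ l]) auto
    have "undo_step_I q (?g, q) = (f, j)"
      unfolding undo_step_I_def prod.case nb nb' Let_def using ex' W l(2,3) i_le_b qj
      by (simp add: fun_eq_iff)
    then show ?thesis using inv' step x by simp
  next
    case G
    have step: "step_I_fun q x = (f, q)" using G i_le_b by (simp add: step_I_fun_def x)
    have "first_low_large f q"
      unfolding first_low_large_def
    proof (intro ballI impI, elim conjE)
      fix k assume k: "k \<in> Q" "q < k" "f k < b" "\<forall>l\<in>Q. q < l \<and> l < k \<longrightarrow> b \<le> f l"
      have "j < k" using between[OF k(1,2)] k(3) f(3) b_less_c by (cases k j rule: linorder_cases) simp_all
      then show "f k < i" using f(10) k qj unfolding first_low_large_def by auto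
    qed
    then have inv': "invariant_I f0 q (f, q)"
    proof (rule invariant_I_intro[rotated 9])
      show "f k = f0 k" if "k < q" for k using that pq f(7) by simp
      show "\<exists>k\<in>Q. w < k \<and> f k < i" if "w \<in> Q" "w < q" "i < f w" "f w < b" for w
        using f(12)[OF that(1) _ that(3,4)] that(2) pq(3) by simp
    qed (use pq(2) G f(5,6,8,11) in simp_all)
    have nb: "next_below f c q = j"
      by (rule next_below_eqI) (use f(1,4) qj between in \<open>auto intro: less_imp_le\<close>)
    have "undo_step_I q (f, q) = (f, j)" unfolding undo_step_I_def prod.case nb Let_def using f(3) by simp
    then show ?thesis using inv' step x by simp
  next
    case H
    have step: "step_I_fun q x = (f, j)" using H i_le_b b_less_c by (simp add: step_I_fun_def x)
    have "c < f k" if "k \<in> Q" "q \<le> k" "k < j" for k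
      using H between[of k] that by (cases "k = q") auto
    then have inv': "invariant_I f0 q (f, j)"
    proof (intro invariant_I_intro)
      show "f k = f0 k" if "k < q" for k using that pq f(7) by simp
      show "\<exists>k\<in>Q. w < k \<and> f k < i" if "w \<in> Q" "w < q" "i < f w" "f w < b" for w
        using f(12)[OF that(1) _ that(3,4)] that(2) pq(3) by simp
    qed (use qj f(1,3-6,8,10,11) in simp_all)
    have "undo_step_I q (f, j) = (f, j)" using qj by (simp add: undo_step_I_def)
    then show ?thesis using inv' step x by simp
  qed
  then show "invariant_I f0 q (step_I_fun q x)" and "undo_step_I q (step_I_fun q x) = x" by auto
qed

text \<open>The critical large arc ends at \<open>r\<close> and the critical small arc, or another middle arc crossing the critical large
one, ends at \<open>s\<close>. Arcs that end beyond \<open>r\<close> are not low: they are small, and one that starts before \<open>b\<close> would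
cross the critical large arc and start before the critical small one.\<close>
definition crossed :: "(nat \<Rightarrow> nat) \<Rightarrow> bool" where
  "crossed f \<longleftrightarrow> valid f \<and> (\<exists>r\<in>Q. b < r \<and> f r < i \<and> (\<forall>j\<in>Q. r < j \<longrightarrow> b < f j)
     \<and> (\<exists>s\<in>Q. r < s \<and> b < f s \<and> f s < c))"

text \<open>The last position whose value is not high. It depends only on the set of positions with values below \<open>c\<close>, which
Algorithm I preserves, so it can be read off from the result. This makes it a better starting point than the
right-hand endpoint of the critical small arc.\<close>
definition topmost :: "(nat \<Rightarrow> nat) \<Rightarrow> nat" where
  "topmost f = Max {j \<in> Q. f j < c}"

definition algorithm_I_fun :: "(nat \<Rightarrow> nat) \<Rightarrow> (nat \<Rightarrow> nat)" where
  "algorithm_I_fun f = fst (sweep step_I_fun {j \<in> Q. c \<le> j \<and> j < topmost f} (f, topmost f))"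

lemma topmost_props:
  assumes "j \<in> Q" "f j < c"
  shows "topmost f \<in> Q" "f (topmost f) < c" "\<And>k. k \<in> Q \<Longrightarrow> f k < c \<Longrightarrow> k \<le> topmost f"
proof -
  have fin: "finite {j \<in> Q. f j < c}" "{j \<in> Q. f j < c} \<noteq> {}" using finite_Q assms by auto
  show "topmost f \<in> Q" "f (topmost f) < c" using Max_in[OF fin] by (auto simp: topmost_def)
  show "k \<le> topmost f" if "k \<in> Q" "f k < c" for k
    using Max_ge[OF fin(1), of k] that by (simp add: topmost_def)
qed

lemma algorithm_I_fun_start_at:
  assumes "crossed f" and s: "s \<in> Q" "b < f s" "f s < c" and high: "\<And>j. j \<in> Q \<Longrightarrow> s < j \<Longrightarrow> b < f j"
  shows "invariant_I f s (f, s)" "c \<le> s"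
proof -
  obtain r where f: "valid f" and r: "r \<in> Q" "b < r" "f r < i" "\<forall>j\<in>Q. r < j \<longrightarrow> b < f j"
    using assms(1) by (auto simp: crossed_def)
  \<comment> \<open>No low value occurs beyond \<open>s\<close>, and the value at \<open>r\<close> is low.\<close>
  have "\<not> s < r" "r \<noteq> s" using high[OF r(1)] r(3) s(2) i_le_b by auto
  then have rs: "r < s" by simp
  show "c \<le> s" using rs adjacent[OF r(1,2)] by simp
  show "invariant_I f s (f, s)"
  proof (rule invariant_I_intro)
    show "first_low_large f s" unfolding first_low_large_def
    proof (intro ballI impI, elim conjE)
      fix k assume k: "k \<in> Q" "s < k" "f k < b"
      then show "f k < i" using high[OF k(1,2)] by simp
    qed
    show "\<exists>k\<in>Q. b < k \<and> f k < i" using r by blast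
    show "\<exists>k\<in>Q. w < k \<and> f k < i" if "w \<in> Q" "i < f w" "f w < b" for w
    proof -
      have "\<not> r < w" "w \<noteq> r" using r(3,4) that by auto
      then show ?thesis using r by (intro bexI[of _ r]) simp_all
    qed
  qed (use s f in simp_all)
qed

lemma algorithm_I_fun_start:
  assumes "crossed f"
  shows "invariant_I f (topmost f) (f, topmost f)" "topmost f \<in> Q" "c \<le> topmost f"
proof -
  obtain r s where r: "r \<in> Q" "f r < i" "\<forall>j\<in>Q. r < j \<longrightarrow> b < f j"
    and s: "s \<in> Q" "r < s" "b < f s" "f s < c"
    using assms by (auto simp: crossed_def)
  note top = topmost_props[of s f, OF s(1,4)]
  have "r < topmost f" using top(3)[OF s(1,4)] s(2) by simp
  then have "b < f (topmost f)" using r(3) top(1) by blast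
  moreover have "b < f j" if "j \<in> Q" "topmost f < j" for j
    using top(3)[OF that(1)] that(2) b_less_c by (meson leD le_less_trans not_le)
  ultimately show "invariant_I f (topmost f) (f, topmost f)" "c \<le> topmost f"
    using algorithm_I_fun_start_at[OF assms top(1) _ top(2)] by blast+
  show "topmost f \<in> Q" by fact
qed

lemma sweep_I_invariant:
  assumes "crossed f" "crossed g" and top: "topmost f = topmost g"
  defines "z \<equiv> \<lambda>f. sweep step_I_fun {j \<in> Q. c \<le> j \<and> j < topmost f} (f, topmost f)"
  shows "invariant_I f c (z f) \<and> invariant_I g c (z g) \<and> (z f = z g \<longrightarrow> f = g)"
proof -
  define K where "K p x y \<longleftrightarrow> invariant_I f p x \<and> invariant_I g p y \<and> (x = y \<longrightarrow> f = g)" for p x y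
  note start = algorithm_I_fun_start[OF assms(1)] algorithm_I_fun_start[OF assms(2)]
  have "K c (z f) (z g)"
    unfolding z_def top[symmetric] using finite_Q start(2)
  proof (rule sweep_invariant[where K = K and c = c])
    show "K (topmost f) (f, topmost f) (g, topmost f)" using start top by (simp add: K_def)
    show "K q (step_I_fun q x) (step_I_fun q y)" if "p \<in> Q" "q \<in> Q" "q < p" "p \<le> topmost f" "c \<le> q"
      "\<And>k. k \<in> Q \<Longrightarrow> q < k \<Longrightarrow> p \<le> k" "K p x y" for p q x y
      using invariant_I_step[OF that(1-3,5,6), of f x] invariant_I_step[OF that(1-3,5,6), of g y] that(7)
      unfolding K_def by metis
  qed (use c start in simp_all)
  then show ?thesis by (simp add: K_def)
qed

text \<open>The value at \<open>c\<close> is less than \<open>c\<close>, hence not high, so the final position \<open>c\<close> cannot be skipped.\<close>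
lemma invariant_I_end:
  assumes "invariant_I f0 c (f, j)" shows "j = c"
proof (rule ccontr)
  assume "j \<noteq> c"
  then have "c < f c" and "valid f" using assms c by (auto simp: invariant_I_def)
  then show False using c by (auto simp: valid_def)
qed

lemma algorithm_I_fun_result:
  assumes "crossed f" shows "invariant_I f c (algorithm_I_fun f, c)"
    and "sweep step_I_fun {j \<in> Q. c \<le> j \<and> j < topmost f} (f, topmost f) = (algorithm_I_fun f, c)"
proof -
  obtain g j where eq: "sweep step_I_fun {j \<in> Q. c \<le> j \<and> j < topmost f} (f, topmost f) = (g, j)" by force
  then have "invariant_I f c (g, j)" using sweep_I_invariant[OF assms assms] by simp
  moreover from this have "j = c" by (rule invariant_I_end)
  ultimately show "invariant_I f c (algorithm_I_fun f, c)"
    and "sweep step_I_fun {j \<in> Q. c \<le> j \<and> j < topmost f} (f, topmost f) = (algorithm_I_fun f, c)"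
    using eq unfolding algorithm_I_fun_def by simp_all
qed

lemma topmost_algorithm_I_fun:
  assumes "crossed f" shows "topmost (algorithm_I_fun f) = topmost f"
proof -
  have "algorithm_I_fun f k < c \<longleftrightarrow> f k < c" for k
    using algorithm_I_fun_result(1)[OF assms] unfolding invariant_I_def prod.case by blast
  then show ?thesis unfolding topmost_def by simp
qed

lemma algorithm_I_fun_inj:
  assumes "crossed f" "crossed g" "algorithm_I_fun f = algorithm_I_fun g" shows "f = g"
proof -
  have "topmost f = topmost g" using topmost_algorithm_I_fun assms by metis
  then show ?thesis
    using sweep_I_invariant[OF assms(1,2)] unfolding algorithm_I_fun_result(2)[OF assms(1)] algorithm_I_fun_result(2)[OF assms(2)] assms(3)
    by blast
qed

text \<open>Between \<open>topmost f\<close> and \<open>s\<close> there are only middle and high values, on which the algorithm does nothing but move its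
pointer; at \<open>s\<close> the pointer is at \<open>s\<close>, since this value is middle.\<close>
lemma algorithm_I_fun_from:
  assumes "crossed f" and s: "s \<in> Q" "c \<le> s" "b < f s" "f s < c" and high: "\<And>j. j \<in> Q \<Longrightarrow> s < j \<Longrightarrow> b < f j"
  shows "fst (sweep step_I_fun {j \<in> Q. c \<le> j \<and> j < s} (f, s)) = algorithm_I_fun f"
proof -
  note top = topmost_props[of s f, OF s(1,4)]
  have le: "s \<le> topmost f" using top(3) s by blast
  have valid: "valid f" using assms(1) by (simp add: crossed_def)
  define K :: "nat \<Rightarrow> (nat \<Rightarrow> nat) \<times> nat \<Rightarrow> (nat \<Rightarrow> nat) \<times> nat \<Rightarrow> bool" where "K p x y \<longleftrightarrow> (\<exists>j. x = (f, j) \<and> p \<le> j \<and> s \<le> p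
    \<and> (\<forall>k\<in>Q. p \<le> k \<and> k < j \<longrightarrow> c < f k))" for p x y
  let ?z = "sweep step_I_fun {j \<in> Q. s \<le> j \<and> j < topmost f} (f, topmost f)"
  have "K s ?z ?z"
    using finite_Q top(1)
  proof (rule sweep_invariant[where K = K and c = s])
    show "K (topmost f) (f, topmost f) (f, topmost f)" using le by (auto simp: K_def)
    show "K q (step_I_fun q x) (step_I_fun q y)" if pq: "p \<in> Q" "q \<in> Q" "q < p" "p \<le> topmost f" "s \<le> q"
      "\<And>k. k \<in> Q \<Longrightarrow> q < k \<Longrightarrow> p \<le> k" "K p x y" for p q x y
    proof -
      obtain j where j: "x = (f, j)" "p \<le> j" "\<forall>k\<in>Q. p \<le> k \<and> k < j \<longrightarrow> c < f k"
        using pq(7) by (auto simp: K_def)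
      have q: "b < f q" using high[OF pq(2)] s(3) pq(5) by (cases "q = s") auto
      then have eq: "step_I_fun q x = (f, if f q < c then q else j)" using i_le_b by (simp add: step_I_fun_def j(1))
      show ?thesis
      proof (cases "f q < c")
        case True
        then show ?thesis unfolding K_def eq using pq(5) by auto
      next
        case False
        have "f q \<noteq> c" using valid pq(2) c by (auto simp: valid_def)
        then have "c < f k" if "k \<in> Q" "q \<le> k" "k < j" for k
          using j(3) pq(6)[OF that(1)] that False by (cases "k = q") auto
        then show ?thesis unfolding K_def eq using False pq(3,5) j(2) by auto
      qed
    qed
  qed (use s le in simp_all)
  then obtain j where z: "?z = (f, j)" "s \<le> j" "\<forall>k\<in>Q. s \<le> k \<and> k < j \<longrightarrow> c < f k"
    by (auto simp: K_def)
  have "j = s" 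
  proof (rule ccontr)
    assume "j \<noteq> s"
    then have "c < f s" using z(2,3) s(1) by simp
    then show False using s(4) by simp
  qed
  have "{j \<in> Q. c \<le> j \<and> j < topmost f} = {j \<in> Q. c \<le> j \<and> j < s} \<union> {j \<in> Q. s \<le> j \<and> j < topmost f}"
    using le s(2) by auto
  then have "sweep step_I_fun {j \<in> Q. c \<le> j \<and> j < topmost f} (f, topmost f)
      = sweep step_I_fun {j \<in> Q. c \<le> j \<and> j < s} ?z"
    using finite_Q by (simp only:) (rule sweep_union, auto)
  then show ?thesis using z(1) \<open>j = s\<close> by (simp add: algorithm_I_fun_def)
qed

lemma next_below_eq_next_large_fun:
  assumes "first_low_large f j" "\<exists>k\<in>Q. j < k \<and> f k < i"
  shows "next_below f b j = next_large_fun f j"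
proof -
  have "\<exists>k\<in>Q. j < k \<and> f k < b" using assms(2) i_le_b by (meson less_le_trans)
  note m = next_below_props[OF this]
  have "f (next_below f b j) < i" using assms(1) m unfolding first_low_large_def by blast
  show ?thesis unfolding next_large_fun_def
  proof (rule Least_equality[symmetric])
    show "next_below f b j \<le> k" if "j < k \<and> k \<in> Q \<and> f k < i" for k
      using m(4)[of k] that i_le_b by (cases "k < next_below f b j") auto
  qed (use m \<open>f (next_below f b j) < i\<close> in blast)
qed

definition preprocessable :: "(nat \<Rightarrow> nat) \<Rightarrow> bool" where
  "preprocessable h \<longleftrightarrow> b \<in> Q \<and> valid h \<and> first_low_large h b \<and> (\<exists>k\<in>Q. b < k \<and> h k < i)"

text \<open>The nearest low value above \<open>b\<close> is large before preprocessing. If preprocessing changes anything, it puts the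
small value from \<open>b\<close> there.\<close>
lemma preprocess_undo:
  assumes "preprocessable h"
  defines "g \<equiv> preprocess_fun b h"
  defines "l \<equiv> next_below g b b"
  shows "h = (if i < g l then g(b := g l, l := g b) else g)" "l \<in> Q" "b < l" "g l < b"
proof -
  have h: "b \<in> Q" "valid h" "first_low_large h b" "\<exists>k\<in>Q. b < k \<and> h k < i"
    using assms(1) by (auto simp: preprocessable_def)
  define m where "m = next_large_fun h b"
  note m = next_large_fun_props[OF h(1,4), folded m_def]
  have eq: "next_below h b b = m" using next_below_eq_next_large_fun[OF h(3,4)] by (simp add: m_def)
  have hb: "h b < b" "h b \<noteq> i" using h(1,2) by (auto simp: valid_def)
  have "\<exists>k\<in>Q. b < k \<and> h k < b" using h(4) i_le_b by (meson less_le_trans)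
  note nb = next_below_props[OF this, unfolded eq]
  have "h = (if i < g l then g(b := g l, l := g b) else g) \<and> l \<in> Q \<and> b < l \<and> g l < b"
  proof (cases "i < h b")
    case True
    then have g: "g = h(b := h m, m := h b)" by (simp add: g_def preprocess_fun_def m_def)
    have l: "l = m" unfolding l_def
    proof (rule next_below_eqI)
      show "b \<le> g k" if "k \<in> Q" "b < k" "k < m" for k using nb(4)[OF that] that g by simp
    qed (use m hb g in simp_all)
    show ?thesis
      unfolding l g using True m hb by (simp add: fun_eq_iff)
  next
    case False
    then have "g = h" by (simp add: g_def preprocess_fun_def)
    moreover from this have "l = m" using eq by (simp add: l_def)
    ultimately show ?thesis
      using m i_le_b by simp
  qed
  then show "h = (if i < g l then g(b := g l, l := g b) else g)" "l \<in> Q" "b < l" "g l < b"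
    by blast+
qed

lemma preprocess_inj:
  assumes "preprocessable g" "preprocessable h" "preprocess_fun b g = preprocess_fun b h" shows "g = h"
  by (rule trans[OF preprocess_undo(1)[OF assms(1)] preprocess_undo(1)[OF assms(2), symmetric, folded assms(3)]])

text \<open>Algorithm I followed by Algorithm II. The set \<open>R\<^sub>2\<close> is empty exactly if \<open>b = i\<close>.\<close>
definition algorithms_fun :: "(nat \<Rightarrow> nat) \<Rightarrow> (nat \<Rightarrow> nat)" where
  "algorithms_fun f = (if b = i then algorithm_I_fun f else algorithm_II_fun b (algorithm_I_fun f))"

lemma algorithm_I_fun_props:
  assumes "crossed f"
  shows "valid (algorithm_I_fun f)" "rearranges Q f (algorithm_I_fun f)" "b < algorithm_I_fun f c" "\<exists>k\<in>Q. b < k \<and> algorithm_I_fun f k < i"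
    "b \<noteq> i \<Longrightarrow> preprocessable (algorithm_I_fun f)"
    "\<exists>k\<in>Q. b \<le> k \<and> algorithm_I_fun f k < i"
proof -
  have h: "b < algorithm_I_fun f c" "valid (algorithm_I_fun f)" "rearranges Q f (algorithm_I_fun f)" "first_low_large (algorithm_I_fun f) c"
     "\<exists>k\<in>Q. b < k \<and> algorithm_I_fun f k < i"
    using algorithm_I_fun_result(1)[OF assms] unfolding invariant_I_def prod.case by blast+
  show "valid (algorithm_I_fun f)" "rearranges Q f (algorithm_I_fun f)" "b < algorithm_I_fun f c" "\<exists>k\<in>Q. b < k \<and> algorithm_I_fun f k < i"
    by (fact h)+
  then show "\<exists>k\<in>Q. b \<le> k \<and> algorithm_I_fun f k < i" using less_imp_le by blast
  \<comment> \<open>The value at \<open>c\<close>, the only position between the pointer and \<open>b\<close>, is middle.\<close>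
  have "first_low_large (algorithm_I_fun f) b" unfolding first_low_large_def
  proof (intro ballI impI, elim conjE)
    fix k assume k: "k \<in> Q" "b < k" "algorithm_I_fun f k < b" "\<forall>l\<in>Q. b < l \<and> l < k \<longrightarrow> b \<le> algorithm_I_fun f l"
    have "c < k" using adjacent[OF k(1,2)] k(3) h(1) by (cases "k = c") auto
    then show "algorithm_I_fun f k < i" using h(4) k b_less_c unfolding first_low_large_def by auto
  qed
  then show "preprocessable (algorithm_I_fun f)" if "b \<noteq> i" 
  proof -
    have "b \<in> Q" using that b by blast
    then show ?thesis using h(2,5) \<open>first_low_large (algorithm_I_fun f) b\<close> unfolding preprocessable_def by blast
  qed
qed

text \<open>The first position beyond \<open>b\<close> is \<open>c\<close>, where the pointer of Algorithm I has ended, so its value is middle.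
The low value beyond \<open>b\<close> distinguishes this case from the one without a critical small arc.\<close>
lemma algorithms_result:
  assumes "crossed f"
  shows "cut_at (algorithms_fun f) b" "\<exists>k\<in>Q. b < k \<and> algorithms_fun f k < b" "valid (algorithms_fun f)" "rearranges Q f (algorithms_fun f)"
proof -
  note h = algorithm_I_fun_props[OF assms]
  have cut: "cut_at g b" if "\<exists>j\<in>Q. g j < i" "b < g c"
      "\<And>j. j \<in> Q \<Longrightarrow> j \<le> b \<Longrightarrow> g j < i \<or> (\<exists>r\<in>Q. g j < r \<and> r < j)" for g
  proof -
    have "b < g j" if "j \<in> Q" "b < j" "\<forall>k\<in>Q. b < k \<longrightarrow> j \<le> k" for j
    proof -
      have "j = c" using that adjacent c b_less_c by (meson le_antisym)
      then show ?thesis using \<open>b < g c\<close> by simp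
    qed
    then show ?thesis unfolding cut_at_def using b that by blast
  qed
  have "cut_at (algorithms_fun f) b \<and> (\<exists>k\<in>Q. b < k \<and> algorithms_fun f k < b) \<and> valid (algorithms_fun f) \<and> rearranges Q f (algorithms_fun f)"
  proof (cases "b = i")
    case True
    have "cut_at (algorithm_I_fun f) b"
    proof (rule cut)
      show "algorithm_I_fun f j < i \<or> (\<exists>r\<in>Q. algorithm_I_fun f j < r \<and> r < j)" if "j \<in> Q" "j \<le> b" for j
        using above_i[OF that(1)] that(2) True by simp
    qed (use h in blast)+
    moreover have "algorithms_fun f = algorithm_I_fun f" unfolding algorithms_fun_def if_P[OF True] ..
    ultimately show ?thesis using h(1,2,4) True by simp
  next
    case False
    then have bQ: "b \<in> Q" using b by simp
    note g = algorithm_II_fun_props[OF bQ h(1,6)]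
    note ready = h(5)[OF False]
    note l = preprocess_undo[OF ready]
    have eq: "algorithms_fun f = algorithm_II_fun b (algorithm_I_fun f)" unfolding algorithms_fun_def if_not_P[OF False] ..
    have "preprocess_fun b (algorithm_I_fun f) c = algorithm_I_fun f c"
      using next_large_fun_props[OF bQ h(4)] h(3) i_le_b b_less_c by (auto simp: preprocess_fun_def)
    then have "cut_at (algorithms_fun f) b"
      unfolding eq using g(3)[OF b_less_c] h(3) by (intro cut[OF g(4) _ g(5)]) simp_all
    moreover have "\<exists>k\<in>Q. b < k \<and> algorithms_fun f k < b"
      unfolding eq
      by (rule bexI[OF _ l(2)]) (use g(3)[OF l(3)] l(3,4) in simp)
    ultimately show ?thesis using g(1,2) rearranges_trans[OF h(2)] unfolding eq by blast
  qed
  then show "cut_at (algorithms_fun f) b" "\<exists>k\<in>Q. b < k \<and> algorithms_fun f k < b" "valid (algorithms_fun f)" "rearranges Q f (algorithms_fun f)"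
    by blast+
qed

lemma algorithms_inj:
  assumes "crossed f" "crossed g" "algorithms_fun f = algorithms_fun g" shows "f = g"
proof -
  note h = algorithm_I_fun_props[OF assms(1)] algorithm_I_fun_props[OF assms(2)]
  have "algorithm_I_fun f = algorithm_I_fun g"
  proof (cases "b = i")
    case False
    then have "b \<in> Q" using b by simp
    then have "preprocess_fun b (algorithm_I_fun f) = preprocess_fun b (algorithm_I_fun g)"
      using algorithm_II_fun_inj[OF _ h(1,6,7,12)] assms(3) unfolding algorithms_fun_def if_not_P[OF False] by blast
    then show ?thesis using preprocess_inj h False by blast
  next
    case True
    show ?thesis using assms(3) unfolding algorithms_fun_def if_P[OF True] .
  qed
  then show ?thesis using algorithm_I_fun_inj assms by blast
qed

end

section \<open>Recovering the input from the output\<close>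

context right_end_set begin

text \<open>The three cases in the definition of the sets \<open>R\<^sub>1\<close> and \<open>R\<^sub>2\<close>: no critical large arc, no small arc crossing it, and
both critical arcs present.\<close>
definition transforms :: "(nat \<Rightarrow> nat) \<Rightarrow> (nat \<Rightarrow> nat) \<Rightarrow> bool" where
  "transforms f g \<longleftrightarrow> valid f \<and> (\<forall>j\<in>Q. i < f j) \<and> g = f
     \<or> (\<exists>t. uncrossed t f \<and> g = algorithm_II_fun t f)
     \<or> (\<exists>b c. window Q i b c \<and> window.crossed Q i b c f \<and> g = window.algorithms_fun Q i b c f)"

lemma transforms_preserves:
  assumes "transforms f g" shows "valid g" "rearranges Q f g"
  using assms uncrossed_result(4,5) window.algorithms_result(3,4) unfolding transforms_def by auto

text \<open>The result determines the case: without a critical large arc there are no large arcs beyond \<open>i\<close> at all; otherwise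
it determines \<open>b\<close>, and then an arc over \<open>b\<close> that starts below \<open>b\<close> reveals the critical small arc.\<close>
lemma transforms_inj:
  assumes "transforms f h" "transforms g h" shows "f = g"
proof -
  have large: "\<exists>j\<in>Q. h j < i" if "cut_at h b" for b using that by (auto simp: cut_at_def)
  consider (none) "\<forall>j\<in>Q. i < f j" "h = f" | (un) t where "uncrossed t f" "h = algorithm_II_fun t f"
    | (cr) b c where "window Q i b c" "window.crossed Q i b c f" "h = window.algorithms_fun Q i b c f"
    using assms(1) unfolding transforms_def by blast
  note f = this
  consider (none) "\<forall>j\<in>Q. i < g j" "h = g" | (un) t where "uncrossed t g" "h = algorithm_II_fun t g"
    | (cr) b c where "window Q i b c" "window.crossed Q i b c g" "h = window.algorithms_fun Q i b c g"
    using assms(2) unfolding transforms_def by blast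
  note g = this
  show ?thesis
  proof (cases rule: f)
    case none
    then have "\<not> cut_at h b" for b using large by force
    note no_cut = this
    show ?thesis
    proof (cases rule: g)
      case (un t)
      then show ?thesis using no_cut uncrossed_result(1) by blast
    next
      case (cr b c)
      then show ?thesis using no_cut window.algorithms_result(1)[OF cr(1,2)] by simp
    qed (use none in simp)
  next
    case (un t)
    note f_un = this
    have h: "cut_at h t" "\<forall>j\<in>Q. t < j \<longrightarrow> t < h j" using uncrossed_result(1,2) un by auto
    show ?thesis
    proof (cases rule: g)
      case none
      then show ?thesis using large[OF h(1)] by force
    next
      case (un t')
      then have "t' = t" using cut_at_unique[OF h(1)] uncrossed_result(1) by metis
      then have un: "uncrossed t g" "algorithm_II_fun t f = algorithm_II_fun t g" using un f_un by auto
      then have "t \<in> Q" "valid f" "\<exists>j\<in>Q. t \<le> j \<and> f j < i" "valid g" "\<exists>j\<in>Q. t \<le> j \<and> g j < i"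
        using f_un(1) by (auto simp: uncrossed_def)
      from algorithm_II_fun_inj[OF this un(2)] show ?thesis using uncrossed_result(3) un(1) f_un(1) by simp
    next
      case (cr b c)
      note r = window.algorithms_result[OF cr(1,2), folded cr(3)]
      have "b = t" using cut_at_unique r(1) h(1) by blast
      then show ?thesis using r(2) h(2) by force
    qed
  next
    case (cr b c)
    note f_cr = this
    note h = window.algorithms_result[OF cr(1,2), folded cr(3)]
    show ?thesis
    proof (cases rule: g)
      case none
      then show ?thesis using large[OF h(1)] by force
    next
      case (un t)
      have "cut_at h t" "\<forall>j\<in>Q. t < j \<longrightarrow> t < h j" using uncrossed_result(1,2) un by auto
      then show ?thesis using cut_at_unique[OF h(1)] h(2) by force
    next
      case (cr b' c')
      have "b' = b" using cut_at_unique window.algorithms_result(1)[OF cr(1,2), folded cr(3)] h(1) by blast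
      moreover from this have "c' = c"
        using cr(1) f_cr(1) window.adjacent window.c window.b_less_c by (metis le_antisym)
      ultimately show ?thesis using window.algorithms_inj cr f_cr by metis
    qed
  qed
qed

end

section \<open>From functions to sets of arcs\<close>

definition arcs_from :: "nat set \<Rightarrow> (nat \<Rightarrow> nat) \<Rightarrow> arcs" where
  "arcs_from R f = (\<lambda>j. (f j, j)) ` R"

lemma in_arcs_from [simp]: "(a, j) \<in> arcs_from R f \<longleftrightarrow> j \<in> R \<and> a = f j"
  by (auto simp: arcs_from_def)

lemma snd_arcs_from [simp]: "snd ` arcs_from R f = R"
  by (force simp: arcs_from_def)

lemma left_of_arcs_from [simp]: "j \<in> R \<Longrightarrow> left_of (arcs_from R f) j = f j"
  by (simp add: left_of_def)

lemma swap_right_arcs_from: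
  assumes "x \<in> R" "y \<in> R" "x \<noteq> y"
  shows "swap_right x y (arcs_from R f) = arcs_from R (f(x := f y, y := f x))"
proof (rule set_eqI)
  fix e :: "nat \<times> nat"
  obtain a j where "e = (a, j)" by (cases e)
  then show "e \<in> swap_right x y (arcs_from R f) \<longleftrightarrow> e \<in> arcs_from R (f(x := f y, y := f x))"
    using assms by (cases "j = x"; cases "j = y") (auto simp: swap_right_def Let_def)
qed

lemma rotate_arcs_from:
  assumes "x \<in> R" "y \<in> R" "z \<in> R" "x \<noteq> y" "x \<noteq> z" "y \<noteq> z"
  shows "(arcs_from R f - {(f x, x), (f y, y), (f z, z)}) \<union> {(f x, y), (f y, z), (f z, x)}
    = arcs_from R (f(x := f z, y := f x, z := f y))" (is "?A = ?B")
proof (rule set_eqI)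
  fix e :: "nat \<times> nat"
  obtain a j where "e = (a, j)" by (cases e)
  then show "e \<in> ?A \<longleftrightarrow> e \<in> ?B"
    using assms by (cases "j = x"; cases "j = y"; cases "j = z") auto
qed

lemma arcs_from_eqD: "arcs_from R f = arcs_from R g \<Longrightarrow> j \<in> R \<Longrightarrow> f j = g j"
  by (metis in_arcs_from)

text \<open>The matching that remains after removal of the last arc, whose left-hand endpoint is \<open>i\<close>.\<close>
locale matching_ends = fixes R :: "nat set" and i :: nat
  assumes finite_R: "finite R" and i_notin: "i \<notin> R"
begin

sublocale right_end_set "{j \<in> R. i < j}" i
  by standard (use finite_R in auto)

abbreviation (input) "Q \<equiv> {j \<in> R. i < j}"

lemma next_large_arcs_from:
  assumes "i \<le> j" shows "next_large i (arcs_from R f) j = next_large_fun f j"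
  unfolding next_large_def next_large_fun_def using assms by (intro arg_cong[where f = Least]) auto

lemma step_II_arcs_from:
  assumes "p \<in> R" "q \<in> R" "q < p"
  shows "step_II i q (arcs_from R f, p) = map_prod (arcs_from R) id (step_II_fun q (f, p))"
  using assms swap_right_arcs_from[of p R q] by (simp add: step_II_def step_II_fun_def)

lemma preprocess_II_arcs_from:
  assumes "t \<in> Q" "i < f t \<Longrightarrow> \<exists>k\<in>Q. t < k \<and> f k < i"
  shows "preprocess_II i t (arcs_from R f) = arcs_from R (preprocess_fun t f)"
proof (cases "i < f t")
  case True
  note l = next_large_fun_props(1,2)[OF assms(1) assms(2)[OF True]]
  have "next_large i (arcs_from R f) t = next_large_fun f t"
    using next_large_arcs_from assms(1) by simp
  then show ?thesis
    using True assms(1) l swap_right_arcs_from[of t R "next_large_fun f t" f]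
    by (simp add: preprocess_II_def preprocess_fun_def)
qed (use assms(1) in \<open>simp add: preprocess_II_def preprocess_fun_def\<close>)

lemma algorithm_II_arcs_from:
  assumes t: "t \<in> Q" and "valid f" and ex: "\<exists>j\<in>Q. t \<le> j \<and> f j < i"
    and R': "R' \<noteq> {}" "Max R' = t"
  shows "algorithm_II i Q R' (arcs_from R f) = arcs_from R (algorithm_II_fun t f)"
proof -
  have "\<exists>k\<in>Q. t < k \<and> f k < i" if "i < f t"
  proof -
    obtain j where "j \<in> Q" "t \<le> j" "f j < i" using ex by blast
    moreover from this have "j \<noteq> t" using that by auto
    ultimately show ?thesis by (intro bexI[of _ j]) simp_all
  qed
  then have preprocess_fun: "preprocess_II i t (arcs_from R f) = arcs_from R (preprocess_fun t f)"
    using preprocess_II_arcs_from[OF t] by blast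
  define K where "K p x y \<longleftrightarrow> invariant_II t (preprocess_fun t f) p x \<and> y = map_prod (arcs_from R) id x" for p x y
  let ?x = "sweep step_II_fun {j \<in> Q. j < t} (preprocess_fun t f, t)"
  let ?y = "sweep (step_II i) {j \<in> Q. j < t} (arcs_from R (preprocess_fun t f), t)"
  have "K (Min Q) ?x ?y"
    unfolding algorithm_II_fun_range_eq
    using finite_Q t
  proof (rule sweep_invariant[where K = K and c = "Min Q"])
    show "K t (preprocess_fun t f, t) (arcs_from R (preprocess_fun t f), t)"
      using algorithm_II_fun_start(1)[OF t assms(2) ex] by (simp add: K_def)
    show "K q (step_II_fun q x) (step_II i q y)" if "p \<in> Q" "q \<in> Q" "q < p" "p \<le> t" "Min Q \<le> q"
      "\<And>k. k \<in> Q \<Longrightarrow> q < k \<Longrightarrow> p \<le> k" "K p x y" for p q x y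
    proof -
      have inv: "invariant_II t (preprocess_fun t f) p x" and y: "y = map_prod (arcs_from R) id x"
        using that(7) by (auto simp: K_def)
      obtain g where x: "x = (g, p)" "valid g" using inv unfolding invariant_II_def by blast
      have "step_II i q y = map_prod (arcs_from R) id (step_II_fun q x)"
        using step_II_arcs_from[of p q g] that(1-3) x y by simp
      then show ?thesis using invariant_II_step[OF that(1-4,6) inv] by (simp add: K_def)
    qed
  qed (use Min_right_end[OF t] in simp_all)
  then have "fst ?y = arcs_from R (fst ?x)" by (simp add: K_def)
  moreover have "algorithm_II i Q R' (arcs_from R f) = fst ?y"
    using R' preprocess_fun by (simp add: algorithm_II_def sweep_def Let_def)
  ultimately show ?thesis by (simp add: algorithm_II_fun_def)
qed

text \<open>Two left-hand endpoints are separated by a right-hand endpoint exactly if they lie on different sides of \<open>b\<close> or of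
\<open>c\<close>, because one of them, at the pointer, lies in the gap.\<close>
lemma step_I_arcs_from:
  assumes w: "window Q i b c" and pq: "p \<in> Q" "q \<in> Q" "q < p" "c \<le> q"
    and next_p: "\<And>k. k \<in> Q \<Longrightarrow> q < k \<Longrightarrow> p \<le> k" and inv: "window.invariant_I Q i b c f0 p x"
  shows "step_I i q (map_prod (arcs_from R) id x) = map_prod (arcs_from R) id (window.step_I_fun Q i b c q x)"
proof -
  interpret window Q i b c by fact
  obtain f j where x: "x = (f, j)" by (cases x)
  have f: "j \<in> Q" "p \<le> j" "b < f j" "f j < c" "valid f"
    using inv unfolding invariant_I_def x prod.case by blast+
  have qj: "q < j" using f pq by simp
  have fq: "f q < q" "f q \<notin> Q" "f q \<noteq> i" using f(5) pq by (auto simp: valid_def)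
  then have fq': "f q \<noteq> b" "f q \<noteq> c" using b c by auto
  have mem: "q \<in> R" "j \<in> R" "q \<noteq> j" using pq f qj by auto
  have left: "left_of (arcs_from R f) j = f j" "left_of (arcs_from R f) q = f q" using mem by simp_all
  consider (L) "f q < i" | (W) "i < f q" "f q < b" | (G) "b < f q" "f q < c" | (H) "c < f q"
    using fq fq' by linarith
  then show ?thesis
  proof cases
    case L
    then show ?thesis using mem swap_right_arcs_from[of j R q f]
      by (simp add: x step_I_def step_I_fun_def Let_def)
  next
    case W
    define l where "l = next_large_fun f j"
    have "\<exists>k\<in>Q. j < k \<and> f k < i" using invariant_I_next_large pq next_p inv W unfolding x by blast
    note l = next_large_fun_props[OF f(1) this, folded l_def]
    have eq: "next_large i (arcs_from R f) j = l" using next_large_arcs_from f(1) by (simp add: l_def)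
    have "b \<in> Q" using b W by auto
    then have "\<exists>r\<in>R. min (f j) (f q) < r \<and> r < max (f j) (f q)" using W f(3) by (intro bexI[of _ b]) auto
    moreover have "\<not> f q < i" "\<not> f j < f q" using W f(3) by auto
    moreover have "left_of (arcs_from R f) l = f l" "l \<in> R" "l \<noteq> j" "l \<noteq> q" using l(1,2) qj by auto
    ultimately show ?thesis using mem rotate_arcs_from[of j R q l f] W
      unfolding x step_I_def step_I_fun_def map_prod_simp prod.case id_apply left snd_arcs_from eq Let_def l_def[symmetric]
      by simp
  next
    case G
    have "\<not> (\<exists>r\<in>R. min (f j) (f q) < r \<and> r < max (f j) (f q))"
    proof clarify
      fix r assume r: "r \<in> R" "min (f j) (f q) < r" "r < max (f j) (f q)"
      then have "b < r" "r < c" using G f(3,4) by auto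
      then show False using adjacent[of r] r(1) i_le_b by auto
    qed
    moreover have "\<not> f q < i" "\<not> f q < b" using G i_le_b by auto
    ultimately show ?thesis using G
      unfolding x step_I_def step_I_fun_def map_prod_simp prod.case id_apply left snd_arcs_from Let_def
      by simp
  next
    case H
    have "\<exists>r\<in>R. min (f j) (f q) < r \<and> r < max (f j) (f q)"
      using H f(4) c by (intro bexI[of _ c]) auto
    moreover have "\<not> f q < i" "\<not> f q < b" "\<not> f q < c" "f j < f q" using H f(4) i_le_b b_less_c by auto
    ultimately show ?thesis
      unfolding x step_I_def step_I_fun_def map_prod_simp prod.case id_apply left snd_arcs_from Let_def
      by simp
  qed
qed

lemma algorithm_I_arcs_from:
  assumes w: "window Q i b c" and cr: "window.crossed Q i b c f"
    and s: "s \<in> Q" "b < f s" "f s < c" and high: "\<And>j. j \<in> Q \<Longrightarrow> s < j \<Longrightarrow> b < f j"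
    and R': "R' = {j \<in> Q. c \<le> j \<and> j \<le> s}"
  shows "algorithm_I i R' s (arcs_from R f) = arcs_from R (window.algorithm_I_fun Q i b c f)"
proof -
  interpret window Q i b c by fact
  note start = algorithm_I_fun_start_at[OF cr s high]
  have eq: "{j \<in> R'. j < s} = {j \<in> Q. c \<le> j \<and> j < s}" "R' \<noteq> {}"
    using s(1) start(2) unfolding R' by auto
  define K where "K p x y \<longleftrightarrow> invariant_I f p x \<and> y = map_prod (arcs_from R) id x" for p x y
  let ?x = "sweep step_I_fun {j \<in> Q. c \<le> j \<and> j < s} (f, s)"
  let ?y = "sweep (step_I i) {j \<in> Q. c \<le> j \<and> j < s} (arcs_from R f, s)"
  have "K c ?x ?y"
    using finite_Q s(1)
  proof (rule sweep_invariant[where K = K and c = c])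
    show "K s (f, s) (arcs_from R f, s)"
      using start(1) by (simp add: K_def)
    show "K q (step_I_fun q x) (step_I i q y)" if "p \<in> Q" "q \<in> Q" "q < p" "p \<le> s" "c \<le> q"
      "\<And>k. k \<in> Q \<Longrightarrow> q < k \<Longrightarrow> p \<le> k" "K p x y" for p q x y
    proof -
      have inv: "invariant_I f p x" and y: "y = map_prod (arcs_from R) id x"
        using that(7) by (auto simp: K_def)
      have "step_I i q y = map_prod (arcs_from R) id (step_I_fun q x)"
        unfolding y by (rule step_I_arcs_from[OF w that(1-3,5,6) inv])
      then show ?thesis using invariant_I_step(1)[OF that(1-3,5,6) inv] by (simp add: K_def)
    qed
  qed (use c start in simp_all)
  then have "fst ?y = arcs_from R (fst ?x)" by (simp add: K_def)
  moreover have "algorithm_I i R' s (arcs_from R f) = fst ?y"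
    unfolding algorithm_I_def eq(1) sweep_def using eq(2) by simp
  ultimately show ?thesis using algorithm_I_fun_from[OF cr s(1) start(2) s(2,3) high] by simp
qed

end

section \<open>One step of the recursion\<close>

text \<open>The two sets of endpoints may overlap: disjoint sets give matchings, and in general these are the arc sets of set
partitions, in which a vertex can end one arc and start another.\<close>
definition arc_systems :: "nat set \<Rightarrow> nat set \<Rightarrow> arcs set" where
  "arc_systems L R = {M. fst ` M = L \<and> snd ` M = R \<and> inj_on fst M \<and> inj_on snd M \<and> (\<forall>(a, b)\<in>M. a < b)}"

lemma arcs_from_in_arc_systems_iff:
  "arcs_from R f \<in> arc_systems L R \<longleftrightarrow> bij_betw f R L \<and> (\<forall>j\<in>R. f j < j)"
proof -
  have fst: "fst ` arcs_from R f = f ` R" by (force simp: arcs_from_def)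
  have "inj_on fst (arcs_from R f) \<longleftrightarrow> inj_on f R"
    by (auto simp: inj_on_def arcs_from_def)
  moreover have "inj_on snd (arcs_from R f)" by (auto simp: inj_on_def)
  ultimately show ?thesis by (auto simp: arc_systems_def fst bij_betw_def)
qed

text \<open>The default value \<open>0\<close> makes the function unique, so that functions can be compared in place of sets of arcs.\<close>
lemma arc_systems_cases:
  assumes "M \<in> arc_systems L R"
  obtains f where "M = arcs_from R f" "\<And>j. j \<notin> R \<Longrightarrow> f j = 0"
proof
  define f where "f j = (if j \<in> R then left_of M j else 0)" for j
  have R: "R = snd ` M" and inj: "inj_on snd M" using assms by (simp_all add: arc_systems_def)
  have "left_of M j = a" if aj: "(a, j) \<in> M" for a j
  proof -
    have "a' = a" if "(a', j) \<in> M" for a'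
      using inj_onD[OF inj _ that aj] by simp
    then show ?thesis unfolding left_of_def using aj by (intro the_equality)
  qed
  then have "M \<subseteq> arcs_from R f" "arcs_from R f \<subseteq> M"
    unfolding arcs_from_def R by (auto simp: f_def R intro: rev_image_eqI)
  then show "M = arcs_from R f" by blast
  show "f j = 0" if "j \<notin> R" for j using that by (simp add: f_def)
qed

context matching_ends begin

text \<open>The work lies in finding the gap: \<open>b\<close> and \<open>c\<close> are the positions next to the left-hand endpoint \<open>l\<close> of the critical
small arc, with \<open>b = i\<close> if there is none below \<open>l\<close>. Minimality of \<open>l\<close> yields that no arc ending beyond the critical
large arc starts below \<open>b\<close>.\<close>
lemma transform_arcs_from:
  assumes inj: "inj_on f R" and f: "\<And>j. j \<in> R \<Longrightarrow> f j < j \<and> f j \<notin> R \<and> f j \<noteq> i" and N: "\<And>j. j \<in> R \<Longrightarrow> j < N"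
  shows "\<exists>g. transforms f g \<and> transform i N (arcs_from R f) = arcs_from R g"
proof -
  let ?M = "arcs_from R f"
  have valid: "valid f" using f by (auto simp: valid_def)
  have re: "right_ends i N ?M = Q" using N by (auto simp: right_ends_def)
  have lc: "large_candidates i N ?M = (\<lambda>j. (f j, j)) ` {j \<in> Q. f j < i}"
    unfolding large_candidates_def re by auto
  define LQ where "LQ = {j \<in> Q. f j < i}"
  show ?thesis
  proof (cases "LQ = {}")
    case True
    then have "large_candidates i N ?M = {}" by (simp add: lc LQ_def)
    then have "transform i N ?M = ?M" by (simp add: transform_def R1_def R2_def algorithm_I_def algorithm_II_def)
    moreover have "i < f j" if "j \<in> Q" for j
    proof -
      have "\<not> f j < i" using True that by (auto simp: LQ_def)
      then show ?thesis using f[of j] that by simp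
    qed
    ultimately show ?thesis using valid unfolding transforms_def by blast
  next
    case False
    have finL: "finite LQ" using finite_R by (simp add: LQ_def)
    define r where "r = Max LQ"
    have "r \<in> LQ" unfolding r_def using Max_in[OF finL False] .
    then have r: "r \<in> Q" "f r < i" by (auto simp: LQ_def)
    \<comment> \<open>As \<open>i\<close> is not a left-hand endpoint of the remaining arcs, an arc that is not large is small.\<close>
    have above_r: "i < f j" if "j \<in> Q" "r < j" for j
    proof -
      have "j \<notin> LQ" using Max_ge[OF finL, of j] that(2) unfolding r_def by auto
      then show ?thesis using that(1) f[of j] by (auto simp: LQ_def)
    qed
    have "snd ` large_candidates i N ?M = LQ" unfolding lc LQ_def by force
    then have cl: "critical_large i N ?M = (f r, r)"
      using r(1) by (simp add: critical_large_def r_def[symmetric] Let_def)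
    have lne: "large_candidates i N ?M \<noteq> {}" using False by (simp add: lc LQ_def)
    define SQ where "SQ = {j \<in> Q. i < f j \<and> f j < r \<and> r < j}"
    have sc: "small_candidates i N ?M = (\<lambda>j. (f j, j)) ` SQ"
    proof -
      have "crosses (f j, j) (f r, r) \<longleftrightarrow> f j < r \<and> r < j" if "i < f j" for j
        using that r(2) by (auto simp: crosses_def)
      moreover have "i < j" if "j \<in> R" "i < f j" for j using f[OF that(1)] that(2) by simp
      ultimately show ?thesis unfolding small_candidates_def cl SQ_def by auto
    qed
    show ?thesis
    proof (cases "SQ = {}")
      case True
      define R' where "R' = {j \<in> Q. j \<le> r}"
      have "small_candidates i N ?M = {}" using True by (simp add: sc)
      note none = if_P[OF this] if_P[OF disjI2, OF this]
      have "R1 i N ?M = {}" unfolding R1_def none ..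
      moreover have "R2 i N ?M = R'"
        unfolding R2_def re cl R'_def none if_not_P[OF lne] by auto
      ultimately have "transform i N ?M = algorithm_II i Q R' ?M"
        by (simp add: transform_def re algorithm_I_def)
      also have "\<dots> = arcs_from R (algorithm_II_fun r f)"
      proof (rule algorithm_II_arcs_from[OF r(1) valid])
        show "\<exists>j\<in>Q. r \<le> j \<and> f j < i" using r by blast
        show "R' \<noteq> {}" using r(1) by (auto simp: R'_def)
        show "Max R' = r" unfolding R'_def by (rule Max_eqI) (use r(1) finite_R in auto)
      qed
      finally have "transform i N ?M = arcs_from R (algorithm_II_fun r f)" .
      moreover have "r < f j" if "j \<in> Q" "r < j" for j
      proof -
        have "\<not> f j < r" using above_r[OF that] True that by (auto simp: SQ_def)
        moreover have "f j \<noteq> r" using f[of j] that(1) r(1) by auto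
        ultimately show ?thesis by simp
      qed
      then have "uncrossed r f" using r valid by (simp add: uncrossed_def)
      ultimately show ?thesis unfolding transforms_def by blast
    next
      case False
      define l where "l = Min (f ` SQ)"
      have finS: "finite (f ` SQ)" "f ` SQ \<noteq> {}" using finite_R False by (auto simp: SQ_def)
      have "l \<in> f ` SQ" unfolding l_def using Min_in[OF finS] .
      then obtain s where "s \<in> SQ" and ls: "l = f s" by blast
      then have s: "s \<in> Q" "i < f s" "f s < r" "r < s" by (auto simp: SQ_def)
      have l_le: "l \<le> f j" if "j \<in> SQ" for j using Min_le[OF finS(1)] that by (simp add: l_def)
      have "fst ` small_candidates i N ?M = f ` SQ" unfolding sc by force
      moreover have "right_of ?M l = s"
        unfolding right_of_def using s(1) inj by (intro the_equality) (auto simp: ls inj_on_def)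
      ultimately have cs: "critical_small i N ?M = (l, s)"
        by (simp add: critical_small_def Let_def l_def[symmetric])
      have sne: "small_candidates i N ?M \<noteq> {}" using False by (simp add: sc)
      define R' where "R' = {j \<in> Q. j < l}"
      define b where "b = (if R' = {} then i else Max R')"
      define c where "c = Min {j \<in> Q. l < j}"
      have l_notin: "l \<notin> R" using f s(1) ls by blast
      have finR': "finite R'" using finite_R by (simp add: R'_def)
      have finc: "finite {j \<in> Q. l < j}" "{j \<in> Q. l < j} \<noteq> {}"
        using finite_R less_trans[OF s(3,4)] s(1) ls by auto
      have cp: "c \<in> Q" "l < c" using Min_in[OF finc] by (auto simp: c_def)
      have c_le: "c \<le> j" if "j \<in> Q" "l < j" for j using Min_le[OF finc(1)] that by (simp add: c_def)
      have bp: "b = i \<or> b \<in> Q" "b < l" "\<And>j. j \<in> Q \<Longrightarrow> j < l \<Longrightarrow> j \<le> b"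
      proof -
        have "R' \<noteq> {} \<Longrightarrow> Max R' \<in> R'" using Max_in[OF finR'] .
        then show "b = i \<or> b \<in> Q" "b < l" using s(2) by (auto simp: b_def R'_def ls)
        show "j \<le> b" if "j \<in> Q" "j < l" for j
        proof -
          have "j \<in> R'" using that by (simp add: R'_def)
          then show ?thesis using Max_ge[OF finR'] by (auto simp: b_def)
        qed
      qed
      have adj: "c \<le> q" if "q \<in> Q" "b < q" for q
      proof -
        have "\<not> q < l" using bp(3)[OF that(1)] that(2) by auto
        moreover have "q \<noteq> l" using l_notin that(1) by auto
        ultimately show ?thesis using c_le[OF that(1)] by simp
      qed
      interpret window Q i b c
        by unfold_locales (use bp cp adj in auto)
      have high: "b < f j" if "j \<in> Q" "r < j" for j
      proof (cases "j \<in> SQ")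
        case True
        then show ?thesis using l_le bp(2) by (meson less_le_trans)
      next
        case False
        then have "\<not> f j < r" using above_r[OF that] that by (auto simp: SQ_def)
        moreover have "b < r" using bp(2) s(3) ls by simp
        ultimately show ?thesis by simp
      qed
      have bs: "b < f s" "f s < c" using bp(2) cp(2) ls by simp_all
      then have "b < r" using s(3) by simp
      then have cr: "crossed f" unfolding crossed_def using valid r s(1,4) bs high by blast
      have window: "window Q i b c" by unfold_locales
      have "c \<le> s" using c_le[OF s(1)] s(3,4) ls by simp
      have l_c: "l < j \<longleftrightarrow> c \<le> j" if "j \<in> Q" for j using c_le[OF that] cp(2) by auto
      have "\<not> (large_candidates i N ?M = {} \<or> small_candidates i N ?M = {})" using lne sne by blast
      note some = if_not_P[OF this]
      have R1: "R1 i N ?M = {j \<in> Q. c \<le> j \<and> j \<le> s}"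
        unfolding R1_def re cs fst_conv snd_conv some using l_c by blast
      have "b < f j" if "j \<in> Q" "s < j" for j using high[OF that(1)] that(2) s(4) by simp
      then have "algorithm_I i (R1 i N ?M) s ?M = arcs_from R (algorithm_I_fun f)"
        by (intro algorithm_I_arcs_from[OF window cr s(1) bs _ R1])
      moreover have "R2 i N ?M = R'"
        unfolding R2_def re cs R'_def if_not_P[OF lne] if_not_P[OF sne] by auto
      ultimately have eq: "transform i N ?M = algorithm_II i Q R' (arcs_from R (algorithm_I_fun f))"
        by (simp add: transform_def re cs)
      have "transform i N ?M = arcs_from R (algorithms_fun f)"
      proof (cases "R' = {}")
        case True
        then have "b = i" by (simp add: b_def)
        then have "algorithms_fun f = algorithm_I_fun f" unfolding algorithms_fun_def by (rule if_P)
        then show ?thesis using eq True by (simp add: algorithm_II_def)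
      next
        case False
        then have bR: "b \<in> R'" "Max R' = b" using Max_in[OF finR'] by (auto simp: b_def)
        then have bQ: "b \<in> Q" by (simp add: R'_def)
        then have "b \<noteq> i" by auto
        then have "algorithms_fun f = algorithm_II_fun b (algorithm_I_fun f)" unfolding algorithms_fun_def by (rule if_not_P)
        moreover note algorithm_II_arcs_from[OF bQ algorithm_I_fun_props(1,6)[OF cr] False bR(2)]
        ultimately show ?thesis using eq by simp
      qed
      then show ?thesis using window cr unfolding transforms_def by blast
    qed
  qed
qed

lemma transform_arc_systems:
  assumes disj: "L \<inter> R = {}" "i \<notin> L" and N: "\<And>j. j \<in> R \<Longrightarrow> j < N"
  shows "transform i N ` arc_systems L R \<subseteq> arc_systems L R" "inj_on (transform i N) (arc_systems L R)"
proof -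
  have rep: "\<exists>f g. M = arcs_from R f \<and> transform i N M = arcs_from R g \<and> transforms f g
     \<and> bij_betw f R L \<and> (\<forall>j\<in>R. f j < j) \<and> (\<forall>j. j \<notin> R \<longrightarrow> f j = 0)" if M: "M \<in> arc_systems L R" for M
  proof -
    obtain f where f: "M = arcs_from R f" "\<And>j. j \<notin> R \<Longrightarrow> f j = 0" using arc_systems_cases[OF M] by blast
    then have "bij_betw f R L" "\<forall>j\<in>R. f j < j" using M arcs_from_in_arc_systems_iff by auto
    moreover from this have "\<exists>g. transforms f g \<and> transform i N (arcs_from R f) = arcs_from R g"
      using disj by (intro transform_arcs_from N) (auto simp: bij_betw_def)
    ultimately show ?thesis using f by blast
  qed
  show "transform i N ` arc_systems L R \<subseteq> arc_systems L R"
  proof clarify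
    fix M assume "M \<in> arc_systems L R"
    then obtain f g where fg: "transform i N M = arcs_from R g" "transforms f g" "bij_betw f R L" "\<forall>j\<in>R. f j < j"
      using rep by blast
    note g = transforms_preserves[OF fg(2)]
    have "bij_betw g R L" using rearranges_bij_betw[OF g(2) _ fg(3)] by blast
    moreover have "g j < j" if "j \<in> R" for j
    proof (cases "j \<in> Q")
      case True
      then show ?thesis using g(1) by (auto simp: valid_def)
    next
      case False
      then show ?thesis using rearranges_outside[OF g(2) False] fg(4) that by simp
    qed
    ultimately show "transform i N M \<in> arc_systems L R"
      unfolding fg(1) arcs_from_in_arc_systems_iff by blast
  qed
  show "inj_on (transform i N) (arc_systems L R)"
  proof (rule inj_onI)
    fix M M' assume M: "M \<in> arc_systems L R" "M' \<in> arc_systems L R" "transform i N M = transform i N M'"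
    obtain f g where f: "M = arcs_from R f" "transform i N M = arcs_from R g" "transforms f g" "\<forall>j. j \<notin> R \<longrightarrow> f j = 0"
      using rep[OF M(1)] by blast
    obtain f' g' where f': "M' = arcs_from R f'" "transform i N M' = arcs_from R g'" "transforms f' g'" "\<forall>j. j \<notin> R \<longrightarrow> f' j = 0"
      using rep[OF M(2)] by blast
    have "g j = g' j" for j
    proof (cases "j \<in> R")
      case True
      then show ?thesis using arcs_from_eqD M(3) f(2) f'(2) by metis
    next
      case False
      then show ?thesis
        using rearranges_outside[OF transforms_preserves(2)[OF f(3)], of j] f(4)
          rearranges_outside[OF transforms_preserves(2)[OF f'(3)], of j] f'(4) by simp
    qed
    then have "g = g'" by blast
    then have "f = f'" using transforms_inj f(3) f'(3) by blast
    then show "M = M'" using f(1) f'(1) by simp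
  qed
qed

end

section \<open>Injectivity on matchings\<close>

text \<open>A map of this kind from a finite set to itself is a bijection, and so surjectivity is never proved directly.\<close>
definition injects_into :: "('a \<Rightarrow> 'b) \<Rightarrow> 'a set \<Rightarrow> 'b set \<Rightarrow> bool" where
  "injects_into f A B \<longleftrightarrow> f ` A \<subseteq> B \<and> inj_on f A"

lemma injects_into_comp:
  "injects_into f A B \<Longrightarrow> injects_into g B C \<Longrightarrow> injects_into (\<lambda>x. g (f x)) A C"
  unfolding injects_into_def inj_on_def by blast

lemma injects_into_cong:
  "injects_into f A B \<Longrightarrow> (\<And>x. x \<in> A \<Longrightarrow> f x = g x) \<Longrightarrow> injects_into g A B"
  unfolding injects_into_def inj_on_def by auto

lemma injects_into_inverse:
  assumes "\<And>x. x \<in> A \<Longrightarrow> f x \<in> B" "\<And>x. x \<in> A \<Longrightarrow> g (f x) = x"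
  shows "injects_into f A B"
  unfolding injects_into_def using assms by (auto intro: inj_on_inverseI[of A g f])

lemma arc_systemsD:
  assumes "M \<in> arc_systems L R"
  shows "fst ` M = L" "snd ` M = R" "inj_on fst M" "inj_on snd M"
    and "(a, b) \<in> M \<Longrightarrow> a \<in> L" "(a, b) \<in> M \<Longrightarrow> b \<in> R" "(a, b) \<in> M \<Longrightarrow> a < b"
    and "a \<in> L \<Longrightarrow> \<exists>b. (a, b) \<in> M" "b \<in> R \<Longrightarrow> \<exists>a. (a, b) \<in> M"
proof -
  show M: "fst ` M = L" "snd ` M = R" "inj_on fst M" "inj_on snd M" "(a, b) \<in> M \<Longrightarrow> a < b"
    using assms by (auto simp: arc_systems_def)
  show "(a, b) \<in> M \<Longrightarrow> a \<in> L" "(a, b) \<in> M \<Longrightarrow> b \<in> R"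
    "a \<in> L \<Longrightarrow> \<exists>b. (a, b) \<in> M" "b \<in> R \<Longrightarrow> \<exists>a. (a, b) \<in> M"
    unfolding M(1,2)[symmetric] by force+
qed

lemma arc_systems_Field: "M \<in> arc_systems L R \<Longrightarrow> Field M = L \<union> R"
  by (simp add: arc_systems_def Field_def Domain_fst Range_snd)

lemma arc_systems_map:
  assumes M: "M \<in> arc_systems L R" and r: "strict_mono_on (L \<union> R) r"
  shows "map_prod r r ` M \<in> arc_systems (r ` L) (r ` R)"
proof -
  have LR: "L = fst ` M" "R = snd ` M" "inj_on fst M" "inj_on snd M" "\<And>a b. (a, b) \<in> M \<Longrightarrow> a < b"
    using M by (auto simp: arc_systems_def)
  have mem: "a \<in> L" "b \<in> R" if "(a, b) \<in> M" for a b
    using that unfolding LR(1,2) by force+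
  have inj: "inj_on r (L \<union> R)" using r by (rule strict_mono_on_imp_inj_on)
  have "inj_on fst (map_prod r r ` M)"
  proof (rule inj_onI, clarsimp)
    fix a b a' b' assume *: "(a, b) \<in> M" "(a', b') \<in> M" "r a = r a'"
    then have "a = a'" using inj_onD[OF inj *(3)] mem by blast
    then show "r b = r b'" using inj_onD[OF LR(3) _ *(1,2)] by simp
  qed
  moreover have "inj_on snd (map_prod r r ` M)"
  proof (rule inj_onI, clarsimp)
    fix a b a' b' assume *: "(a, b) \<in> M" "(a', b') \<in> M" "r b = r b'"
    then have "b = b'" using inj_onD[OF inj *(3)] mem by blast
    then show "r a = r a'" using inj_onD[OF LR(4) _ *(1,2)] by simp
  qed
  moreover have "r a < r b" if "(a, b) \<in> M" for a b
    using strict_mono_onD[OF r _ _ LR(5)[OF that]] mem[OF that] by blast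
  moreover have "fst ` map_prod r r ` M = r ` L" "snd ` map_prod r r ` M = r ` R"
    unfolding LR(1,2) image_image by auto
  ultimately show ?thesis unfolding arc_systems_def by auto
qed

lemma arc_systems_map_inverse:
  assumes M: "M \<in> arc_systems L R" and s: "\<And>x. x \<in> L \<union> R \<Longrightarrow> s (r x) = x"
  shows "map_prod s s ` map_prod r r ` M = M"
proof -
  have "map_prod s s (map_prod r r e) = e" if "e \<in> M" for e
  proof -
    have "fst e \<in> L" "snd e \<in> R" using M that by (auto simp: arc_systems_def)
    then show ?thesis using s by (cases e) simp
  qed
  then show ?thesis unfolding image_image by simp
qed

lemma rank_strict_mono: "finite V \<Longrightarrow> strict_mono_on V (rank V)"
proof (rule strict_mono_onI)
  fix x y assume "finite V" "x \<in> V" "y \<in> V" "x < y"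
  then have "{u \<in> V. u \<le> x} \<subset> {u \<in> V. u \<le> y}" by force
  then show "rank V x < rank V y" unfolding rank_def using \<open>finite V\<close> by (intro psubset_card_mono) auto
qed

lemma rank_image: assumes "finite V" shows "rank V ` V = {1..card V}"
proof -
  have "inj_on (rank V) V" using strict_mono_on_imp_inj_on[OF rank_strict_mono[OF assms]] .
  then have "card (rank V ` V) = card V" by (rule card_image)
  moreover have "rank V ` V \<subseteq> {1..card V}"
  proof clarify
    fix v assume "v \<in> V"
    then have "{u \<in> V. u \<le> v} \<noteq> {}" by blast
    then show "rank V v \<in> {1..card V}"
      unfolding rank_def using assms by (auto simp: Suc_le_eq card_gt_0_iff intro: card_mono)
  qed
  ultimately show ?thesis by (intro card_subset_eq) auto
qed

lemma relabelled_injects: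
  assumes fin: "finite (L \<union> R)"
    and F: "injects_into F (arc_systems (rank (L \<union> R) ` L) (rank (L \<union> R) ` R))
      (arc_systems (rank (L \<union> R) ` L) (rank (L \<union> R) ` R))"
  shows "injects_into (relabelled F) (arc_systems L R) (arc_systems L R)"
proof -
  define r where "r = rank (L \<union> R)"
  define s where "s = the_inv_into (L \<union> R) r"
  have mono: "strict_mono_on (L \<union> R) r" using rank_strict_mono[OF fin] by (simp add: r_def)
  then have inj: "inj_on r (L \<union> R)" by (rule strict_mono_on_imp_inj_on)
  have sr: "s (r x) = x" if "x \<in> L \<union> R" for x using the_inv_into_f_f[OF inj that] by (simp add: s_def)
  have rs: "r (s y) = y" if "y \<in> r ` L \<union> r ` R" for y using that sr by auto
  have mono': "strict_mono_on (r ` L \<union> r ` R) s"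
  proof (rule strict_mono_onI)
    fix x y assume xy: "x \<in> r ` L \<union> r ` R" "y \<in> r ` L \<union> r ` R" "x < y"
    then obtain a b where "x = r a" "y = r b" "a \<in> L \<union> R" "b \<in> L \<union> R" by auto
    moreover from this have "a < b" using xy(3) strict_mono_on_less[OF mono] by blast
    ultimately show "s x < s y" using sr by simp
  qed
  have img: "s ` r ` L = L" "s ` r ` R = R" unfolding image_image using sr by auto
  let ?A = "arc_systems (r ` L) (r ` R)"
  have 1: "injects_into (\<lambda>M. map_prod r r ` M) (arc_systems L R) ?A"
    using arc_systems_map[OF _ mono] arc_systems_map_inverse[where s = s and r = r] sr
    by (intro injects_into_inverse[where g = "\<lambda>M. map_prod s s ` M"]) blast+
  have 3: "injects_into (\<lambda>M. map_prod s s ` M) ?A (arc_systems L R)"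
    using arc_systems_map[OF _ mono', unfolded img] arc_systems_map_inverse[where s = r and r = s] rs
    by (intro injects_into_inverse[where g = "\<lambda>M. map_prod r r ` M"]) blast+
  show ?thesis
  proof (rule injects_into_cong)
    show "injects_into (\<lambda>M. map_prod s s ` F (map_prod r r ` M)) (arc_systems L R) (arc_systems L R)"
      using injects_into_comp[OF injects_into_comp[OF 1 F[folded r_def]] 3] .
    show "map_prod s s ` F (map_prod r r ` M) = relabelled F M" if "M \<in> arc_systems L R" for M
      unfolding relabelled_def arc_systems_Field[OF that] Let_def r_def s_def ..
  qed
qed

lemma arc_systems_remove:
  assumes M: "M \<in> arc_systems L R" and ij: "(i, j) \<in> M"
  shows "M - {(i, j)} \<in> arc_systems (L - {i}) (R - {j})"
proof -
  note D = arc_systemsD[OF M]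
  have "fst ` (M - {(i, j)}) = L - {i}" "snd ` (M - {(i, j)}) = R - {j}"
    by (subst inj_on_image_set_diff[where C = M]; use D(1-4) ij in simp)+
  moreover have "inj_on fst (M - {(i, j)})" "inj_on snd (M - {(i, j)})"
    using D(3,4) by (blast intro: inj_on_subset)+
  ultimately show ?thesis using D(7) unfolding arc_systems_def by blast
qed

lemma arc_systems_insert:
  assumes M: "M \<in> arc_systems (L - {i}) (R - {j})" and "i \<in> L" "j \<in> R" "i < j"
  shows "insert (i, j) M \<in> arc_systems L R"
proof -
  note D = arc_systemsD[OF M]
  have "fst ` insert (i, j) M = L" "snd ` insert (i, j) M = R"
    using D(1,2) assms(2,3) by (simp_all add: insert_absorb)
  moreover have "i \<notin> fst ` M" "j \<notin> snd ` M" unfolding D(1,2) by simp_all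
  then have "inj_on fst (insert (i, j) M)" "inj_on snd (insert (i, j) M)"
    unfolding inj_on_insert fst_conv snd_conv using D(3,4) by blast+
  ultimately show ?thesis using D(7) assms(4) unfolding arc_systems_def by blast
qed

lemma arc_systems_left_of:
  assumes "M \<in> arc_systems L R" "(i, j) \<in> M" shows "left_of M j = i"
proof -
  obtain f where "M = arcs_from R f" using arc_systems_cases[OF assms(1)] by blast
  then show ?thesis using assms(2) by simp
qed

lemma arc_systems_last:
  assumes "M \<in> arc_systems L R" "L \<union> R = {1..N}" "0 < N"
  shows "N \<in> R"
proof (rule ccontr)
  assume "N \<notin> R"
  have N: "N \<in> L \<union> R" unfolding assms(2) using assms(3) by simp
  with \<open>N \<notin> R\<close> have "N \<in> L" by blast
  then obtain b where b: "(N, b) \<in> M" using arc_systemsD(8)[OF assms(1)] by blast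
  then have "b \<in> R" "N < b" using arc_systemsD(6,7)[OF assms(1)] by blast+
  then have "b \<in> {1..N}" unfolding assms(2)[symmetric] by blast
  then show False using \<open>N < b\<close> by simp
qed

lemma disjoint_image: "inj_on f (L \<union> R) \<Longrightarrow> L \<inter> R = {} \<Longrightarrow> f ` L \<inter> f ` R = {}"
  unfolding inj_on_def by blast

text \<open>The last arc \<open>(i, N)\<close> belongs to the result and thereby determines \<open>i\<close>. For fixed \<open>i\<close>, the rest of the result is
obtained from the rest of the matching by the relabelled recursive call and \<open>transform i N\<close>, both injective.\<close>
lemma phi_std_injects:
  assumes "L \<inter> R = {}" "L \<union> R = {1..2 * m}"
  shows "injects_into (phi_std m) (arc_systems L R) (arc_systems L R)"
  using assms
proof (induction m arbitrary: L R)
  case 0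
  then show ?case by (simp add: injects_into_def)
next
  case (Suc k)
  note IH = Suc.IH and disj = Suc.prems(1) and union = Suc.prems(2)
  show ?case
  proof (cases k)
    case 0
    then show ?thesis by (simp add: injects_into_def)
  next
    case (Suc m)
    define N where "N = 2 * Suc (Suc m)"
    have fin: "finite L" "finite R" using union finite_subset[of _ "L \<union> R"] by auto
    define T where "T M = transform (left_of M N) N (relabelled (phi_std (Suc m)) (M - {(left_of M N, N)}))" for M
    have phi: "phi_std (Suc (Suc m)) M = insert (left_of M N, N) (T M)" for M
      by (simp add: N_def T_def Let_def)
    define B where "B i = arc_systems (L - {i}) (R - {N})" for i
    have step: "left_of M N \<in> L \<and> left_of M N < N \<and> N \<in> R \<and> (left_of M N, N) \<in> M \<and> M - {(left_of M N, N)} \<in> B (left_of M N)"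
      if M: "M \<in> arc_systems L R" for M
    proof -
      have "N \<in> R" using arc_systems_last[OF M union[unfolded Suc]] by (simp add: N_def)
      moreover obtain i where i: "(i, N) \<in> M" using arc_systemsD(9)[OF M \<open>N \<in> R\<close>] by blast
      moreover have "left_of M N = i" using arc_systems_left_of[OF M i] .
      moreover have "i \<in> L" "i < N" using arc_systemsD(5,7)[OF M i] .
      ultimately show ?thesis using arc_systems_remove[OF M i] by (simp add: B_def)
    qed
    have inj: "injects_into (\<lambda>M. transform i N (relabelled (phi_std (Suc m)) M)) (B i) (B i)"
      if i: "i \<in> L" "N \<in> R" for i
    proof -
      define V where "V = (L - {i}) \<union> (R - {N})"
      have "V = {1..N} - {i, N}" using disj union Suc i by (auto simp: V_def N_def)
      moreover have "i \<noteq> N" using disj i by auto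
      moreover have "i \<in> {1..N}" "N \<in> {1..N}" using union Suc i by (auto simp: N_def)
      ultimately have card: "card V = 2 * Suc m" by (simp add: N_def card_Diff_subset)
      have finV: "finite V" using fin by (simp add: V_def)
      have inj: "inj_on (rank V) V" using strict_mono_on_imp_inj_on[OF rank_strict_mono[OF finV]] .
      have "injects_into (phi_std (Suc m)) (arc_systems (rank V ` (L - {i})) (rank V ` (R - {N})))
          (arc_systems (rank V ` (L - {i})) (rank V ` (R - {N})))"
        proof (rule IH[unfolded Suc])
          show "rank V ` (L - {i}) \<inter> rank V ` (R - {N}) = {}"
            using disjoint_image[OF inj[unfolded V_def]] disj unfolding V_def by blast
          show "rank V ` (L - {i}) \<union> rank V ` (R - {N}) = {1..2 * Suc m}"
            using rank_image[OF finV] card unfolding image_Un[symmetric] V_def by simp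
      qed
      then have 1: "injects_into (relabelled (phi_std (Suc m))) (B i) (B i)"
        unfolding B_def using finV unfolding V_def by (intro relabelled_injects)
      interpret matching_ends "R - {N}" i by standard (use fin i disj in auto)
      have "j < N" if "j \<in> R - {N}" for j
      proof -
        have "j \<in> {1..N}" using that union Suc by (auto simp: N_def)
        then show ?thesis using that by auto
      qed
      then have "injects_into (transform i N) (B i) (B i)"
        unfolding injects_into_def B_def using transform_arc_systems[of "L - {i}" N] disj by blast
      with 1 show ?thesis by (rule injects_into_comp)
    qed
    have T: "T M \<in> B (left_of M N)" if "M \<in> arc_systems L R" for M
      using inj[of "left_of M N"] step[OF that] unfolding injects_into_def T_def by blast
    have out: "phi_std (Suc (Suc m)) M \<in> arc_systems L R" if M: "M \<in> arc_systems L R" for M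
      unfolding phi using arc_systems_insert[OF T[OF M, unfolded B_def]] step[OF M] by blast
    show ?thesis unfolding injects_into_def Suc
    proof (intro conjI inj_onI)
      show "phi_std (Suc (Suc m)) ` arc_systems L R \<subseteq> arc_systems L R" using out by blast
      fix M M' assume M: "M \<in> arc_systems L R" and M': "M' \<in> arc_systems L R"
        and eq: "phi_std (Suc (Suc m)) M = phi_std (Suc (Suc m)) M'"
      have left: "left_of (phi_std (Suc (Suc m)) X) N = left_of X N" if "X \<in> arc_systems L R" for X
        using arc_systems_left_of[OF out[OF that]] phi by blast
      define i where "i = left_of M N"
      have i': "left_of M' N = i" using left[OF M] left[OF M'] eq by (simp add: i_def)
      have "(i, N) \<notin> X" if "X \<in> B i" for X
        using arc_systemsD(5)[OF that[unfolded B_def]] by blast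
      then have "(i, N) \<notin> T M" "(i, N) \<notin> T M'" using T[OF M] T[OF M'] unfolding i' i_def[symmetric] by blast+
      then have TT: "T M = T M'"
        using eq unfolding phi i' i_def[symmetric] by (rule insert_ident[THEN iffD1])
      note st = step[OF M, folded i_def] step[OF M', unfolded i']
      have "inj_on (\<lambda>M. transform i N (relabelled (phi_std (Suc m)) M)) (B i)"
        using inj[of i] st(1) unfolding injects_into_def by blast
      then have "M - {(i, N)} = M' - {(i, N)}"
        by (rule inj_onD) (use TT st in \<open>unfold T_def i' i_def[symmetric], blast+\<close>)
      moreover have "(i, N) \<in> M" "(i, N) \<in> M'" using st by blast+
      ultimately show "M = M'" by blast
    qed
  qed
qed

lemma phi_matching_injects:
  assumes fin: "finite L" "finite R" and disj: "L \<inter> R = {}"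
  shows "injects_into phi_matching (arc_systems L R) (arc_systems L R)"
proof (cases "arc_systems L R = {}")
  case False
  have card: "card M = card L" "card M = card R" if "M \<in> arc_systems L R" for M
    using that by (auto simp: arc_systems_def card_image)
  with False have LR: "card L = card R" by fastforce
  define V where "V = L \<union> R"
  have finV: "finite V" using fin by (simp add: V_def)
  have cardV: "card V = 2 * card R" using fin disj LR by (simp add: V_def card_Un_disjoint)
  have inj: "inj_on (rank V) (L \<union> R)"
    using strict_mono_on_imp_inj_on[OF rank_strict_mono[OF finV]] unfolding V_def .
  have "injects_into (phi_std (card R)) (arc_systems (rank V ` L) (rank V ` R)) (arc_systems (rank V ` L) (rank V ` R))"
  proof (rule phi_std_injects)
    show "rank V ` L \<inter> rank V ` R = {}" using disjoint_image[OF inj disj] .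
    show "rank V ` L \<union> rank V ` R = {1..2 * card R}"
      using rank_image[OF finV] cardV unfolding image_Un[symmetric] V_def by simp
  qed
  then have "injects_into (relabelled (phi_std (card R))) (arc_systems L R) (arc_systems L R)"
    unfolding V_def using fin by (intro relabelled_injects) auto
  then show ?thesis by (rule injects_into_cong) (simp add: phi_matching_def card(2))
qed (simp add: injects_into_def)

section \<open>Splitting and merging vertices\<close>

lemma merge_split_arcs: "merge_arcs (split_arcs E) = E"
  by (simp add: merge_arcs_def split_arcs_def image_image case_prod_unfold)

lemma split_arcs_in:
  assumes "E \<in> arc_systems L R"
  shows "split_arcs E \<in> arc_systems ((\<lambda>i. 2 * i + 1) ` L) ((\<lambda>j. 2 * j) ` R)"
proof -
  have LR: "L = fst ` E" "R = snd ` E" "inj_on fst E" "inj_on snd E" "\<And>a b. (a, b) \<in> E \<Longrightarrow> a < b"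
    using assms by (auto simp: arc_systems_def)
  have "inj_on fst (split_arcs E)"
  proof (rule inj_onI, clarsimp simp: split_arcs_def)
    fix a b b' assume *: "(a, b) \<in> E" "(a, b') \<in> E"
    then show "b = b'" using inj_onD[OF LR(3) _ *] by simp
  qed
  moreover have "inj_on snd (split_arcs E)"
  proof (rule inj_onI, clarsimp simp: split_arcs_def)
    fix a a' b assume *: "(a, b) \<in> E" "(a', b) \<in> E"
    then show "a = a'" using inj_onD[OF LR(4) _ *] by simp
  qed
  moreover have "fst ` split_arcs E = (\<lambda>i. 2 * i + 1) ` L" "snd ` split_arcs E = (\<lambda>j. 2 * j) ` R"
    unfolding LR(1,2) split_arcs_def image_image by (simp_all add: case_prod_unfold)
  moreover have "a < b" if "(a, b) \<in> split_arcs E" for a b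
    using that LR(5) by (fastforce simp: split_arcs_def)
  ultimately show ?thesis unfolding arc_systems_def by blast
qed

lemma split_merge_arcs:
  assumes "M \<in> arc_systems ((\<lambda>i. 2 * i + 1) ` L) ((\<lambda>j. 2 * j) ` R)"
  shows "split_arcs (merge_arcs M) = M"
proof -
  have "(2 * (a div 2) + 1, 2 * (b div 2)) = (a, b)" if "(a, b) \<in> M" for a b
    using arc_systemsD(5,6)[OF assms that] by auto
  then have "(\<lambda>(a, b). (2 * (a div 2) + 1, 2 * (b div 2))) ` M = id ` M"
    by (intro image_cong) auto
  then show ?thesis by (simp add: merge_arcs_def split_arcs_def image_image case_prod_unfold)
qed

lemma merge_arcs_in:
  assumes M: "M \<in> arc_systems ((\<lambda>i. 2 * i + 1) ` L) ((\<lambda>j. 2 * j) ` R)"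
  shows "merge_arcs M \<in> arc_systems L R"
proof -
  note D = arc_systemsD[OF M]
  have mem: "\<exists>i\<in>L. a = 2 * i + 1" "\<exists>j\<in>R. b = 2 * j" if "(a, b) \<in> M" for a b
    using D(5,6)[OF that] by blast+
  have "(\<lambda>a. a div 2) ` fst ` M = L" "(\<lambda>a. a div 2) ` snd ` M = R"
    unfolding D(1,2) image_image by simp_all
  then have "fst ` merge_arcs M = L" "snd ` merge_arcs M = R"
    unfolding merge_arcs_def image_image case_prod_unfold fst_conv snd_conv .
  moreover have "inj_on fst (merge_arcs M)"
  proof (rule inj_onI, clarsimp simp: merge_arcs_def)
    fix a b a' b' assume *: "(a, b) \<in> M" "(a', b') \<in> M" "a div 2 = a' div 2"
    then have "a = a'" using mem(1)[OF *(1)] mem(1)[OF *(2)] by auto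
    then show "b div 2 = b' div 2" using inj_onD[OF D(3) _ *(1,2)] by simp
  qed
  moreover have "inj_on snd (merge_arcs M)"
  proof (rule inj_onI, clarsimp simp: merge_arcs_def)
    fix a b a' b' assume *: "(a, b) \<in> M" "(a', b') \<in> M" "b div 2 = b' div 2"
    then have "b = b'" using mem(2)[OF *(1)] mem(2)[OF *(2)] by auto
    then show "a div 2 = a' div 2" using inj_onD[OF D(4) _ *(1,2)] by simp
  qed
  moreover have "a < b" if merged: "(a, b) \<in> merge_arcs M" for a b
  proof -
    obtain a' b' where ab: "(a', b') \<in> M" "a = a' div 2" "b = b' div 2"
      using merged unfolding merge_arcs_def by fast
    then show ?thesis using mem[OF ab(1)] D(7)[OF ab(1)] by auto
  qed
  ultimately show ?thesis unfolding arc_systems_def by blast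
qed

lemma merged_phi_injects:
  assumes fin: "finite L" "finite R"
  shows "injects_into (\<lambda>E. merge_arcs (phi_matching (split_arcs E))) (arc_systems L R) (arc_systems L R)"
proof -
  let ?A = "arc_systems ((\<lambda>i. 2 * i + 1) ` L) ((\<lambda>j. 2 * j) ` R)"
  have 1: "injects_into split_arcs (arc_systems L R) ?A"
    using split_arcs_in merge_split_arcs by (rule injects_into_inverse)
  have "(\<lambda>i. 2 * i + 1) ` L \<inter> (\<lambda>j. 2 * j) ` R = {}"
    by (auto, presburger)
  then have 2: "injects_into phi_matching ?A ?A" using fin by (intro phi_matching_injects) auto
  have 3: "injects_into merge_arcs ?A (arc_systems L R)"
    using merge_arcs_in split_merge_arcs by (rule injects_into_inverse)
  show ?thesis using injects_into_comp[OF injects_into_comp[OF 1 2] 3] .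
qed

section \<open>Set partitions and their arcs\<close>

lemma block_unique:
  assumes "partition_on V P" "B \<in> P" "B' \<in> P" "x \<in> B" "x \<in> B'" shows "B = B'"
  using disjointD[OF partition_onD2[OF assms(1)] assms(2,3)] assms(4,5) by blast

lemma block_finite:
  assumes "partition_on V P" "finite V" "B \<in> P" shows "finite B" "B \<subseteq> V" "B \<noteq> {}"
proof -
  show "B \<subseteq> V" using partition_onD1[OF assms(1)] assms(3) by blast
  then show "finite B" using assms(2) by (rule finite_subset)
  show "B \<noteq> {}" using partition_onD3[OF assms(1)] assms(3) by blast
qed

text \<open>Neighbouring elements of a block form an arc; a longer distance is split at an element in between.\<close>
lemma block_arcs_mono:
  assumes P: "partition_on V P" and B: "B \<in> P" "x \<in> B" "y \<in> B" "x \<le> y"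
  shows "(x, y) \<in> (block_arcs P)\<^sup>*"
  using B
proof (induction "y - x" arbitrary: x y rule: less_induct)
  case less
  consider "x = y" | "x < y" "\<exists>k\<in>B. x < k \<and> k < y" | "x < y" "\<not> (\<exists>k\<in>B. x < k \<and> k < y)"
    using le_imp_less_or_eq[OF less.prems(4)] by blast
  then show ?case
  proof cases
    case 2
    then obtain k where k: "k \<in> B" "x < k" "k < y" by blast
    have "(x, k) \<in> (block_arcs P)\<^sup>*"
      by (rule less.hyps[OF _ less.prems(1,2) k(1)]) (use k in simp_all)
    moreover have "(k, y) \<in> (block_arcs P)\<^sup>*"
      by (rule less.hyps[OF _ less.prems(1) k(1) less.prems(3)]) (use k in simp_all)
    ultimately show ?thesis by (rule rtrancl_trans)
  next
    case 3
    then have "(x, y) \<in> block_arcs P" using less.prems unfolding block_arcs_def by blast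
    then show ?thesis by blast
  qed simp
qed

lemma partition_of_block_arcs:
  assumes P: "partition_on V P" shows "partition_of_arcs V (block_arcs P) = P"
proof -
  let ?E = "block_arcs P"
  have same: "\<exists>B\<in>P. x \<in> B \<and> y \<in> B" if "(x, y) \<in> (?E \<union> ?E\<inverse>)\<^sup>*" "x \<in> V" for x y
    using that(1)
  proof induction
    case base
    then show ?case using partition_onD1[OF P] that(2) by blast
  next
    case (step y z)
    then obtain B where B: "B \<in> P" "x \<in> B" "y \<in> B" by blast
    from step.hyps(2) obtain B' where "B' \<in> P" "y \<in> B'" "z \<in> B'" unfolding block_arcs_def by blast
    then show ?case using B block_unique[OF P] by blast
  qed
  have conn: "(x, y) \<in> (?E \<union> ?E\<inverse>)\<^sup>*" if B: "B \<in> P" "x \<in> B" "y \<in> B" for B x y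
  proof (cases "x \<le> y")
    case True
    then show ?thesis using block_arcs_mono[OF P B] rtrancl_mono[of ?E "?E \<union> ?E\<inverse>"] by blast
  next
    case False
    then have "(y, x) \<in> ?E\<^sup>*" using block_arcs_mono[OF P B(1,3,2)] by simp
    then have "(x, y) \<in> (?E\<inverse>)\<^sup>*" by (simp add: rtrancl_converse)
    then show ?thesis using rtrancl_mono[of "?E\<inverse>" "?E \<union> ?E\<inverse>"] by blast
  qed
  have "{(x, y) \<in> V \<times> V. (x, y) \<in> (?E \<union> ?E\<inverse>)\<^sup>*} = {(x, y). \<exists>B\<in>P. x \<in> B \<and> y \<in> B}"
    using same conn partition_onD1[OF P] by blast
  then show ?thesis unfolding partition_of_arcs_def using partition_on_eq_quotient[OF P] by simp
qed

lemma block_arcs_in_arc_systems: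
  assumes P: "partition_on V P" and V: "finite V"
  shows "block_arcs P \<in> arc_systems (V - Max ` P) (V - Min ` P)"
proof -
  let ?E = "block_arcs P"
  note fin = block_finite[OF P V]
  have arc: "\<exists>B\<in>P. i \<in> B \<and> j \<in> B \<and> i < j \<and> (\<forall>k\<in>B. i < k \<longrightarrow> j \<le> k) \<and> (\<forall>k\<in>B. k < j \<longrightarrow> k \<le> i)"
    if "(i, j) \<in> ?E" for i j
  proof -
    obtain B where B: "B \<in> P" "i \<in> B" "j \<in> B" "i < j" and none: "\<not> (\<exists>k\<in>B. i < k \<and> k < j)"
      using \<open>(i, j) \<in> ?E\<close> unfolding block_arcs_def by blast
    have "\<forall>k\<in>B. i < k \<longrightarrow> j \<le> k" "\<forall>k\<in>B. k < j \<longrightarrow> k \<le> i" using none not_le by blast+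
    then show ?thesis using B by blast
  qed
  have ex_right: "\<exists>j. (i, j) \<in> ?E" if i: "i \<in> V" "i \<notin> Max ` P" for i
  proof -
    obtain B where B: "B \<in> P" "i \<in> B" using partition_onD1[OF P] i(1) by blast
    have "i \<noteq> Max B" using i(2) B(1) by blast
    then have "i < Max B" using Max_ge[OF fin(1)[OF B(1)] B(2)] by simp
    then have ne: "{k \<in> B. i < k} \<noteq> {}" "finite {k \<in> B. i < k}"
      using Max_in[OF fin(1)[OF B(1)] fin(3)[OF B(1)]] fin(1)[OF B(1)] by (blast, simp)
    have "Min {k \<in> B. i < k} \<in> B" "i < Min {k \<in> B. i < k}" using Min_in[OF ne(2,1)] by blast+
    moreover have "\<not> (\<exists>k\<in>B. i < k \<and> k < Min {k \<in> B. i < k})"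
      using Min_le[OF ne(2)] not_le by blast
    ultimately have "(i, Min {k \<in> B. i < k}) \<in> ?E" using B unfolding block_arcs_def by blast
    then show ?thesis ..
  qed
  have ex_left: "\<exists>i. (i, j) \<in> ?E" if j: "j \<in> V" "j \<notin> Min ` P" for j
  proof -
    obtain B where B: "B \<in> P" "j \<in> B" using partition_onD1[OF P] j(1) by blast
    have "j \<noteq> Min B" using j(2) B(1) by blast
    then have "Min B < j" using Min_le[OF fin(1)[OF B(1)] B(2)] by simp
    then have ne: "{k \<in> B. k < j} \<noteq> {}" "finite {k \<in> B. k < j}"
      using Min_in[OF fin(1)[OF B(1)] fin(3)[OF B(1)]] fin(1)[OF B(1)] by (blast, simp)
    have "Max {k \<in> B. k < j} \<in> B" "Max {k \<in> B. k < j} < j" using Max_in[OF ne(2,1)] by blast+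
    moreover have "\<not> (\<exists>k\<in>B. Max {k \<in> B. k < j} < k \<and> k < j)"
      using Max_ge[OF ne(2)] not_le by blast
    ultimately have "(Max {k \<in> B. k < j}, j) \<in> ?E" using B unfolding block_arcs_def by blast
    then show ?thesis ..
  qed
  have ends: "i \<in> V - Max ` P" "j \<in> V - Min ` P" if "(i, j) \<in> ?E" for i j
  proof -
    obtain B where B: "B \<in> P" "i \<in> B" "j \<in> B" "i < j" using arc[OF \<open>(i, j) \<in> ?E\<close>] by blast
    have "i \<noteq> Max B'" if "B' \<in> P" for B'
    proof
      assume "i = Max B'"
      then have "i \<in> B'" using Max_in[OF fin(1)[OF that] fin(3)[OF that]] by simp
      then have "B' = B" using block_unique[OF P that B(1)] B(2) by blast
      then show False using Max_ge[OF fin(1)[OF B(1)] B(3)] B(4) \<open>i = Max B'\<close> by simp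
    qed
    then show "i \<in> V - Max ` P" using fin(2)[OF B(1)] B(2) by blast
    have "j \<noteq> Min B'" if "B' \<in> P" for B'
    proof
      assume "j = Min B'"
      then have "j \<in> B'" using Min_in[OF fin(1)[OF that] fin(3)[OF that]] by simp
      then have "B' = B" using block_unique[OF P that B(1)] B(3) by blast
      then show False using Min_le[OF fin(1)[OF B(1)] B(2)] B(4) \<open>j = Min B'\<close> by simp
    qed
    then show "j \<in> V - Min ` P" using fin(2)[OF B(1)] B(3) by blast
  qed
  have "fst ` ?E = V - Max ` P"
  proof (intro equalityI subsetI)
    show "i \<in> V - Max ` P" if "i \<in> fst ` ?E" for i using that ends(1) by fastforce
    fix i assume "i \<in> V - Max ` P"
    then obtain j where "(i, j) \<in> ?E" using ex_right by blast
    then show "i \<in> fst ` ?E" by (rule image_eqI[rotated]) simp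
  qed
  moreover have "snd ` ?E = V - Min ` P"
  proof (intro equalityI subsetI)
    show "j \<in> V - Min ` P" if "j \<in> snd ` ?E" for j using that ends(2) by fastforce
    fix j assume "j \<in> V - Min ` P"
    then obtain i where "(i, j) \<in> ?E" using ex_left by blast
    then show "j \<in> snd ` ?E" by (rule image_eqI[rotated]) simp
  qed
  moreover have "inj_on fst ?E"
  proof (rule inj_onI, clarsimp)
    fix i j j' assume *: "(i, j) \<in> ?E" "(i, j') \<in> ?E"
    obtain B where B: "B \<in> P" "i \<in> B" "j \<in> B" "i < j" "\<forall>k\<in>B. i < k \<longrightarrow> j \<le> k" using arc[OF *(1)] by blast
    obtain B' where B': "B' \<in> P" "i \<in> B'" "j' \<in> B'" "i < j'" "\<forall>k\<in>B'. i < k \<longrightarrow> j' \<le> k"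
      using arc[OF *(2)] by blast
    have "B' = B" using block_unique[OF P B'(1) B(1) B'(2) B(2)] .
    then have "j \<le> j'" "j' \<le> j" using B(3-5) B'(3-5) by blast+
    then show "j = j'" by (rule le_antisym)
  qed
  moreover have "inj_on snd ?E"
  proof (rule inj_onI, clarsimp)
    fix i i' j assume *: "(i, j) \<in> ?E" "(i', j) \<in> ?E"
    obtain B where B: "B \<in> P" "i \<in> B" "j \<in> B" "i < j" "\<forall>k\<in>B. k < j \<longrightarrow> k \<le> i" using arc[OF *(1)] by blast
    obtain B' where B': "B' \<in> P" "i' \<in> B'" "j \<in> B'" "i' < j" "\<forall>k\<in>B'. k < j \<longrightarrow> k \<le> i'"
      using arc[OF *(2)] by blast
    have "B' = B" using block_unique[OF P B'(1) B(1) B'(3) B(3)] .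
    then have "i \<le> i'" "i' \<le> i" using B(2,4,5) B'(2,4,5) by blast+
    then show "i = i'" by (rule le_antisym)
  qed
  moreover have "i < j" if "(i, j) \<in> ?E" for i j using arc[OF that] by blast
  ultimately show ?thesis unfolding arc_systems_def by blast
qed

text \<open>Every vertex starts at most one arc and ends at most one arc, so a walk that turns around only retraces its
steps.\<close>
lemma connected_comparable:
  assumes E: "E \<in> arc_systems L R" and xy: "(x, y) \<in> (E \<union> E\<inverse>)\<^sup>*"
  shows "(x, y) \<in> E\<^sup>* \<or> (y, x) \<in> E\<^sup>*"
  using xy
proof induction
  case (step y z)
  have right: "b = b'" if "(a, b) \<in> E" "(a, b') \<in> E" for a b b'
    using inj_onD[OF arc_systemsD(3)[OF E] _ that] by simp
  have left: "a = a'" if "(a, b) \<in> E" "(a', b) \<in> E" for a a' b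
    using inj_onD[OF arc_systemsD(4)[OF E] _ that] by simp
  show ?case
  proof (cases "(y, z) \<in> E")
    case True
    note yz = this
    show ?thesis
    proof (cases "(x, y) \<in> E\<^sup>*")
      case True
      then show ?thesis using yz by (blast intro: rtrancl_into_rtrancl)
    next
      case False
      then have "(y, x) \<in> E\<^sup>*" "y \<noteq> x" using step.IH by auto
      then obtain w where "(y, w) \<in> E" "(w, x) \<in> E\<^sup>*" by (blast elim: converse_rtranclE)
      then show ?thesis using right[OF yz] by blast
    qed
  next
    case False
    then have zy: "(z, y) \<in> E" using step.hyps(2) by blast
    show ?thesis
    proof (cases "(y, x) \<in> E\<^sup>*")
      case True
      then show ?thesis using zy by (blast intro: converse_rtrancl_into_rtrancl)
    next
      case False
      then have "(x, y) \<in> E\<^sup>*" "x \<noteq> y" using step.IH by auto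
      then obtain w where "(x, w) \<in> E\<^sup>*" "(w, y) \<in> E" by (blast elim: rtranclE)
      then show ?thesis using left[OF zy] by blast
    qed
  qed
qed blast

text \<open>A set of arcs of the right shape, and the partition into its connected components. By \<open>connected_comparable\<close>
each component is a chain of arcs: its minimum is the vertex that ends no arc, and its maximum the one that starts
none.\<close>
locale arc_partition =
  fixes V S T :: "nat set" and E :: arcs
  assumes finite_V: "finite V" and S: "S \<subseteq> V" and T: "T \<subseteq> V" and E: "E \<in> arc_systems (V - T) (V - S)"
begin

definition conn :: "(nat \<times> nat) set" where
  "conn = {(x, y) \<in> V \<times> V. (x, y) \<in> (E \<union> E\<inverse>)\<^sup>*}"

abbreviation "P \<equiv> partition_of_arcs V E"

lemma arcD: "(i, j) \<in> E \<Longrightarrow> i \<in> V \<and> i \<notin> T \<and> j \<in> V \<and> j \<notin> S \<and> i < j"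
  using arc_systemsD(5,6,7)[OF E] by blast

lemma P_eq: "P = V // conn" by (simp add: partition_of_arcs_def conn_def)

lemma equiv_conn: "equiv V conn"
proof (rule equivI)
  show "conn \<subseteq> V \<times> V" by (auto simp: conn_def)
  show "refl_on V conn" by (auto simp: refl_on_def conn_def)
  have "sym ((E \<union> E\<inverse>)\<^sup>*)" by (intro sym_rtrancl) (auto simp: sym_def)
  then show "sym conn" unfolding conn_def by (auto simp: sym_def)
  show "trans conn" unfolding conn_def by (auto simp: trans_def intro: rtrancl_trans)
qed

lemma partition: "partition_on V P"
  unfolding P_eq using equiv_conn by (rule partition_on_quotient)

lemma path_le: "(x, y) \<in> E\<^sup>* \<Longrightarrow> x \<le> y"
  by (induction rule: rtrancl_induct) (use arcD in force)+

lemma arc_same_block: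
  assumes "B \<in> P" "(i, j) \<in> E" shows "i \<in> B \<longleftrightarrow> j \<in> B"
proof -
  have "(i, j) \<in> conn" "(j, i) \<in> conn" using arcD[OF assms(2)] assms(2) by (auto simp: conn_def)
  then show ?thesis using assms(1) equiv_conn unfolding P_eq
    by (meson in_quotient_imp_closed)
qed

lemma block_path:
  assumes "B \<in> P" "x \<in> B" "y \<in> B" shows "(x, y) \<in> E\<^sup>* \<or> (y, x) \<in> E\<^sup>*"
proof -
  have "(x, y) \<in> conn"
    using in_quotient_imp_in_rel[OF equiv_conn, of B x y] assms unfolding P_eq by simp
  then show ?thesis using connected_comparable[OF E] by (simp add: conn_def)
qed

lemma Min_block: assumes "B \<in> P" "s \<in> B" "s \<in> S" shows "Min B = s"
proof (rule Min_eqI)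
  show "finite B" using block_finite(1)[OF partition finite_V assms(1)] .
  show "s \<le> y" if "y \<in> B" for y
  proof (cases "(y, s) \<in> E\<^sup>* \<and> y \<noteq> s")
    case True
    then obtain w where "(w, s) \<in> E" by (blast elim: rtranclE)
    then show ?thesis using arcD assms(3) by blast
  next
    case False
    then show ?thesis using block_path[OF assms(1,2) that] path_le by blast
  qed
qed fact

lemma Max_block: assumes "B \<in> P" "t \<in> B" "t \<in> T" shows "Max B = t"
proof (rule Max_eqI)
  show "finite B" using block_finite(1)[OF partition finite_V assms(1)] .
  show "y \<le> t" if "y \<in> B" for y
  proof (cases "(t, y) \<in> E\<^sup>* \<and> y \<noteq> t")
    case True
    then obtain w where "(t, w) \<in> E" by (blast elim: converse_rtranclE)
    then show ?thesis using arcD assms(3) by blast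
  next
    case False
    then show ?thesis using block_path[OF assms(1,2) that] path_le by blast
  qed
qed fact

lemma block_of: "x \<in> V \<Longrightarrow> \<exists>B\<in>P. x \<in> B"
  using partition_onD1[OF partition] by blast

lemma Min_image: "Min ` P = S"
proof
  show "Min ` P \<subseteq> S"
  proof clarify
    fix B assume B: "B \<in> P"
    note fin = block_finite[OF partition finite_V B]
    have m: "Min B \<in> B" using Min_in[OF fin(1,3)] .
    show "Min B \<in> S"
    proof (rule ccontr)
      assume "Min B \<notin> S"
      then obtain a where a: "(a, Min B) \<in> E" using arc_systemsD(9)[OF E] m fin(2) by blast
      then have "a \<in> B" using arc_same_block[OF B] m by blast
      then show False using Min_le[OF fin(1)] arcD[OF a] by (simp add: leD)
    qed
  qed
  show "S \<subseteq> Min ` P"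
  proof
    fix x assume x: "x \<in> S"
    then obtain B where "B \<in> P" "x \<in> B" using block_of S by blast
    then show "x \<in> Min ` P" using Min_block[OF _ _ x] by blast
  qed
qed

lemma Max_image: "Max ` P = T"
proof
  show "Max ` P \<subseteq> T"
  proof clarify
    fix B assume B: "B \<in> P"
    note fin = block_finite[OF partition finite_V B]
    have m: "Max B \<in> B" using Max_in[OF fin(1,3)] .
    show "Max B \<in> T"
    proof (rule ccontr)
      assume "Max B \<notin> T"
      then obtain b where b: "(Max B, b) \<in> E" using arc_systemsD(8)[OF E] m fin(2) by blast
      then have "b \<in> B" using arc_same_block[OF B] m by blast
      then show False using Max_ge[OF fin(1)] arcD[OF b] by (simp add: leD)
    qed
  qed
  show "T \<subseteq> Max ` P"
  proof
    fix x assume x: "x \<in> T"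
    then obtain B where "B \<in> P" "x \<in> B" using block_of T by blast
    then show "x \<in> Max ` P" using Max_block[OF _ _ x] by blast
  qed
qed

lemma block_arcs_P: "block_arcs P = E"
proof (intro equalityI subsetI)
  fix e assume "e \<in> E"
  then obtain i j where e: "e = (i, j)" "(i, j) \<in> E" by (cases e) simp
  obtain B where B: "B \<in> P" "i \<in> B" using block_of arcD[OF e(2)] by blast
  have "\<not> (\<exists>k\<in>B. i < k \<and> k < j)"
  proof clarify
    fix k assume k: "k \<in> B" "i < k" "k < j"
    have "(i, k) \<in> E\<^sup>*" "i \<noteq> k" using block_path[OF B k(1)] path_le leD k(2) by blast+
    then obtain w where w: "(i, w) \<in> E" "(w, k) \<in> E\<^sup>*" by (blast elim: converse_rtranclE)
    have "w = j" using inj_onD[OF arc_systemsD(3)[OF E] _ w(1) e(2)] by simp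
    then show False using path_le[OF w(2)] k(3) by simp
  qed
  then show "e \<in> block_arcs P"
    using B arc_same_block[OF B(1) e(2)] arcD[OF e(2)] unfolding block_arcs_def e(1) by blast
next
  fix e assume "e \<in> block_arcs P"
  moreover obtain i j where e: "e = (i, j)" by (cases e)
  ultimately obtain B where B: "B \<in> P" "i \<in> B" "j \<in> B" "i < j" "\<not> (\<exists>k\<in>B. i < k \<and> k < j)"
    unfolding block_arcs_def by blast
  have "(i, j) \<in> E\<^sup>*" "i \<noteq> j" using block_path[OF B(1-3)] path_le leD B(4) by blast+
  then obtain w where w: "(i, w) \<in> E" "(w, j) \<in> E\<^sup>*" by (blast elim: converse_rtranclE)
  have "w \<in> B" "i < w" using arc_same_block[OF B(1) w(1)] B(2) arcD[OF w(1)] by blast+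
  moreover have "w \<le> j" using path_le[OF w(2)] .
  ultimately have "w = j" using B(5) le_imp_less_or_eq by blast
  then show "e \<in> E" using w(1) e by simp
qed

end

section \<open>The bijection\<close>

theorem theorem6:
  fixes n :: nat and S T :: "nat set"
  assumes "0 < n" and "S \<subseteq> {1..n}" and "T \<subseteq> {1..n}" and "card S = card T"
  shows "bij_betw phi (partitions_min_max n S T) (partitions_min_max n S T)"
proof -
  let ?X = "partitions_min_max n S T" and ?A = "arc_systems ({1..n} - T) ({1..n} - S)"
  have X: "partition_on {1..n} P" "Min ` P = S" "Max ` P = T" if "P \<in> ?X" for P
    using that by (auto simp: partitions_min_max_def)
  have 1: "injects_into block_arcs ?X ?A"
  proof (rule injects_into_inverse)
    show "block_arcs P \<in> ?A" if "P \<in> ?X" for P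
      using block_arcs_in_arc_systems[OF X(1)[OF that]] X(2,3)[OF that] by simp
    show "partition_of_arcs {1..n} (block_arcs P) = P" if "P \<in> ?X" for P
      using partition_of_block_arcs[OF X(1)[OF that]] .
  qed
  have 2: "injects_into (\<lambda>E. merge_arcs (phi_matching (split_arcs E))) ?A ?A"
    by (rule merged_phi_injects) auto
  have 3: "injects_into (partition_of_arcs {1..n}) ?A ?X"
  proof (rule injects_into_inverse)
    fix E assume "E \<in> ?A"
    then interpret arc_partition "{1..n}" S T E by unfold_locales (use assms in auto)
    show "P \<in> ?X" using partition Min_image Max_image by (simp add: partitions_min_max_def)
    show "block_arcs P = E" by (rule block_arcs_P)
  qed
  have "injects_into phi ?X ?X"
  proof (rule injects_into_cong[OF injects_into_comp[OF injects_into_comp[OF 1 2] 3]])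
    show "partition_of_arcs {1..n} (merge_arcs (phi_matching (split_arcs (block_arcs P)))) = phi P"
      if "P \<in> ?X" for P
      using X(1)[OF that] by (simp add: phi_def partition_on_def)
  qed
  moreover have "finite ?X"
  proof (rule finite_subset)
    show "?X \<subseteq> Pow (Pow {1..n})" by (auto simp: partitions_min_max_def partition_on_def)
  qed simp
  ultimately show ?thesis unfolding injects_into_def bij_betw_def using endo_inj_surj by blast
qed

end
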